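(* Let $s\in(0,1)$, let $\Omega\subset\mathbb{R}^N$ be a bounded $\mathcal{C}^2$ domain, let $q\in L^\infty(\Omega;\mathbb{R}^N)$, and let $c_0\in\mathbb{R}$. Let $u\in\mathcal{C}^2(\overline\Omega)\cap\mathcal{C}(\mathbb{R}^N)$ be bounded on $\mathbb{R}^N$ and satisfy $$-\Delta u+(-\Delta)^s u+q\cdot\nabla u\ge0\quad\text{in }\Omega.$$ Let $x_0\in\partial\Omega$, and assume that $u=c_0$ on $B_{R_0}(x_0)\cap\partial\Omega$ for some $R_0>0$ and $u\ge c_0$ in $\mathbb{R}^N$. If $u\not\equiv c_0$ in $\mathbb{R}^N$, then $\partial_\nu u(x_0)<0$, where $\nu$ is the outer unit normal to $\partial\Omega$ at $x_0$.
   Context: The fractional Laplacian is $(-\Delta)^s u(x)=C_{N,s}\lim_{\varepsilon\to0^+}\int_{\mathbb{R}^N\setminus B_\varepsilon(x)}\frac{u(x)-u(y)}{|x-y|^{N+2s}}\,dy$, with $C_{N,s}=\pi^{-N/2}2^{2s}s\,\Gamma(\frac N2+s)/\Gamma(1-s)$. *)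

theory Defs
  imports "HOL-Analysis.Analysis"
begin

definition d1 :: "('a::euclidean_space \<Rightarrow> real) \<Rightarrow> 'a \<Rightarrow> 'a \<Rightarrow> real" where
  "d1 u b x = frechet_derivative u (at x) b"

definition d2 :: "('a::euclidean_space \<Rightarrow> real) \<Rightarrow> 'a \<Rightarrow> 'a \<Rightarrow> 'a \<Rightarrow> real" where
  "d2 u b c x = frechet_derivative (d1 u b) (at x) c"

definition C2_on :: "'a::euclidean_space set \<Rightarrow> ('a \<Rightarrow> real) \<Rightarrow> bool" where
  "C2_on S f \<longleftrightarrow>
     (\<forall>x\<in>S. f differentiable (at x)) \<and>
     (\<forall>b\<in>Basis. \<forall>x\<in>S. d1 f b differentiable (at x)) \<and>
     (\<forall>b\<in>Basis. \<forall>c\<in>Basis. continuous_on S (d2 f b c))"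

definition C2_closure :: "'a::euclidean_space set \<Rightarrow> ('a \<Rightarrow> real) \<Rightarrow> bool" where
  "C2_closure \<Omega> u \<longleftrightarrow>
     C2_on \<Omega> u \<and> continuous_on (closure \<Omega>) u \<and>
     (\<forall>b\<in>Basis. \<exists>g. continuous_on (closure \<Omega>) g \<and> (\<forall>x\<in>\<Omega>. g x = d1 u b x)) \<and>
     (\<forall>b\<in>Basis. \<forall>c\<in>Basis. \<exists>g. continuous_on (closure \<Omega>) g \<and> (\<forall>x\<in>\<Omega>. g x = d2 u b c x))"

definition hproj :: "'a::euclidean_space \<Rightarrow> 'a \<Rightarrow> 'a" where
  "hproj e x = x - (x \<bullet> e) *\<^sub>R e"

text \<open>A local C^2 boundary chart at x0: in the ball of radius r around x0, Omega is the
  region below the graph of a C^2 function phi over the hyperplane orthogonal to e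
  (i.e. after a rotation, Omega is locally {x_N < phi(x')}).\<close>
definition C2_chart :: "'a::euclidean_space set \<Rightarrow> 'a \<Rightarrow> real \<Rightarrow> 'a \<Rightarrow> ('a \<Rightarrow> real) \<Rightarrow> bool" where
  "C2_chart \<Omega> x0 r e \<phi> \<longleftrightarrow>
     0 < r \<and> norm e = 1 \<and> C2_on UNIV \<phi> \<and>
     \<Omega> \<inter> ball x0 r = {x \<in> ball x0 r. x \<bullet> e < \<phi> (hproj e x)}"

definition C2_domain :: "'a::euclidean_space set \<Rightarrow> bool" where
  "C2_domain \<Omega> \<longleftrightarrow> open \<Omega> \<and> connected \<Omega> \<and> \<Omega> \<noteq> {} \<and>
     (\<forall>x0\<in>frontier \<Omega>. \<exists>r e \<phi>. C2_chart \<Omega> x0 r e \<phi>)"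

definition grad :: "('a::euclidean_space \<Rightarrow> real) \<Rightarrow> 'a \<Rightarrow> 'a" where
  "grad f x = (\<Sum>b\<in>Basis. frechet_derivative f (at x) b *\<^sub>R b)"

text \<open>nu is the outer unit normal to the boundary of Omega at x0: computed in a C^2 chart
  as the normalised gradient of the local defining function x \<bullet> e - phi(x').\<close>
definition outer_unit_normal :: "'a::euclidean_space set \<Rightarrow> 'a \<Rightarrow> 'a \<Rightarrow> bool" where
  "outer_unit_normal \<Omega> x0 \<nu> \<longleftrightarrow>
     (\<exists>r e \<phi>. C2_chart \<Omega> x0 r e \<phi> \<and>
        (let \<psi> = (\<lambda>x. x \<bullet> e - \<phi> (hproj e x)) in \<nu> = (1 / norm (grad \<psi> x0)) *\<^sub>R grad \<psi> x0))"

text \<open>Normal derivative at a boundary point of u in C^2(closure Omega): the value at x0 of the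
  continuous extension of the directional derivative along nu.\<close>
definition normal_deriv :: "'a::euclidean_space set \<Rightarrow> ('a \<Rightarrow> real) \<Rightarrow> 'a \<Rightarrow> 'a \<Rightarrow> real" where
  "normal_deriv \<Omega> u x0 \<nu> = Lim (at x0 within \<Omega>) (\<lambda>x. frechet_derivative u (at x) \<nu>)"

definition laplacian :: "('a::euclidean_space \<Rightarrow> real) \<Rightarrow> 'a \<Rightarrow> real" where
  "laplacian u x = (\<Sum>b\<in>Basis. d2 u b b x)"

definition frac_const :: "nat \<Rightarrow> real \<Rightarrow> real" where
  "frac_const N s = pi powr (- real N / 2) * 2 powr (2 * s) * s
      * Gamma (real N / 2 + s) / Gamma (1 - s)"

definition frac_lap :: "real \<Rightarrow> ('a::euclidean_space \<Rightarrow> real) \<Rightarrow> 'a \<Rightarrow> real" where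
  "frac_lap s u x = frac_const DIM('a) s *
     Lim (at_right 0) (\<lambda>\<epsilon>. LINT y : - ball x \<epsilon> | lborel.
            (u x - u y) / dist x y powr (real DIM('a) + 2 * s))"

end

theory Submission
  imports Defs
begin

text \<open>Pairing \<open>x + h\<close> with \<open>x - h\<close> writes the fractional Laplacian on \<open>\<Omega>\<close> as an absolutely
  convergent integral that depends continuously on \<open>x\<close>, so the differential inequality, with
  \<open>q \<cdot> \<nabla>u\<close> relaxed to \<open>C |\<nabla>u|\<close>, holds at every point of \<open>\<Omega>\<close>. If \<open>u\<close> attained \<open>c0\<close> inside
  \<open>\<Omega>\<close>, the nonlocal term there would be strictly negative; hence \<open>u > c0\<close> in \<open>\<Omega>\<close>. In an interior
  ball touching \<open>x0\<close> the classical barrier \<open>A (exp (- \<alpha> |x - y|\<^sup>2) - exp (- \<alpha> r\<^sup>2))\<close> works: where it touches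
  \<open>u - c0\<close> from below up to a constant, convexity of \<open>exp\<close> bounds the nonlocal term by \<open>O(\<alpha>)\<close> times
  the Gaussian, whereas the Laplacian contributes order \<open>\<alpha>\<^sup>2\<close>. So \<open>u - c0\<close> grows at least linearly
  along the inner normal.\<close>

subsection \<open>Integration on Euclidean space\<close>

lemma tendsto_integral_dominated:
  fixes f :: "'c::first_countable_topology \<Rightarrow> 'a \<Rightarrow> 'b::{banach, second_countable_topology}"
  assumes meas: "\<And>x. f x \<in> borel_measurable M" "g \<in> borel_measurable M"
    and dominating: "integrable M w"
    and pointwise: "AE h in M. ((\<lambda>x. f x h) \<longlongrightarrow> g h) (at a within S)"
    and bound: "\<forall>\<^sub>F x in at a within S. AE h in M. norm (f x h) \<le> w h"
  shows "((\<lambda>x. LINT h|M. f x h) \<longlongrightarrow> (LINT h|M. g h)) (at a within S)"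
  unfolding tendsto_at_iff_sequentially
proof (intro allI impI)
  fix X assume "\<forall>n. X n \<in> S - {a}" "X \<longlonglongrightarrow> a"
  then have X: "filterlim X (at a within S) sequentially"
    by (simp add: filterlim_at)
  obtain n0 where n0: "\<And>n. n \<ge> n0 \<Longrightarrow> AE h in M. norm (f (X n) h) \<le> w h"
    using eventually_compose_filterlim[OF bound X] by (auto simp: eventually_sequentially)
  have X_shift: "filterlim (\<lambda>n. X (n + n0)) (at a within S) sequentially"
    using X by (rule filterlim_compose) (rule filterlim_add_const_nat_at_top)
  have "(\<lambda>n. LINT h|M. f (X (n + n0)) h) \<longlonglongrightarrow> (LINT h|M. g h)"
  proof (rule integral_dominated_convergence[OF meas(2) meas(1) dominating])
    show "AE h in M. (\<lambda>n. f (X (n + n0)) h) \<longlonglongrightarrow> g h"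
      using pointwise by eventually_elim (rule filterlim_compose[OF _ X_shift])
  qed (simp add: n0)
  then show "((\<lambda>x. LINT h|M. f x h) \<circ> X) \<longlonglongrightarrow> (LINT h|M. g h)"
    unfolding comp_def by (rule LIMSEQ_offset)
qed

lemma tendsto_integral_outside_ball:
  fixes f :: "'a::euclidean_space \<Rightarrow> real"
  assumes "integrable lborel f"
  shows "((\<lambda>\<epsilon>. LINT h : - ball a \<epsilon>|lborel. f h) \<longlongrightarrow> (LINT h|lborel. f h)) (at_right 0)"
  unfolding set_lebesgue_integral_def
proof (rule tendsto_integral_dominated)
  show "integrable lborel (\<lambda>h. \<bar>f h\<bar>)"
    using assms by simp
  show "AE h in lborel. ((\<lambda>\<epsilon>. indicator (- ball a \<epsilon>) h *\<^sub>R f h) \<longlongrightarrow> f h) (at_right 0)"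
    using AE_lborel_singleton[of a]
  proof eventually_elim
    case (elim h)
    then have "\<forall>\<^sub>F \<epsilon> in at_right 0. \<epsilon> < dist a h"
      by (intro order_tendstoD(2)[OF tendsto_ident_at]) simp
    then have "\<forall>\<^sub>F \<epsilon> in at_right 0. indicator (- ball a \<epsilon>) h *\<^sub>R f h = f h"
      by eventually_elim simp
    then show ?case
      by (rule tendsto_eventually)
  qed
  show "\<forall>\<^sub>F \<epsilon> in at_right 0. AE h in lborel. norm (indicator (- ball a \<epsilon>) h *\<^sub>R f h) \<le> \<bar>f h\<bar>"
    by (intro always_eventually allI AE_I2) (simp add: indicator_def)
qed (use assms in measurable)

lemma integral_lborel_symmetrize:
  fixes f :: "'a::euclidean_space \<Rightarrow> real"
  assumes meas [measurable]: "f \<in> borel_measurable borel"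
    and int: "integrable lborel (\<lambda>h. f (x + h))"
  shows "(LINT y|lborel. f y) = (LINT h|lborel. f (x + h) + f (x - h)) / 2"
proof -
  have distr: "distr lborel borel (\<lambda>h. x + c *\<^sub>R h) = lborel" if "\<bar>c\<bar> = 1" for c
    using lborel_affine[of c x] that by (auto simp: density_1)
  have shifted: "(LINT h|lborel. f (x + c *\<^sub>R h)) = (LINT y|lborel. f y)"
    "integrable lborel (\<lambda>h. f (x + c *\<^sub>R h)) \<longleftrightarrow> integrable lborel f" if "\<bar>c\<bar> = 1" for c
    using integral_distr[of "\<lambda>h. x + c *\<^sub>R h" lborel borel f]
      integrable_distr_eq[of "\<lambda>h. x + c *\<^sub>R h" lborel borel f] distr[OF that]
    by simp_all
  show ?thesis
    using shifted[of 1] shifted[of "-1"] int by simp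
qed

lemma AE_nonneg_imp_nonneg_on_open:
  fixes f :: "'a::euclidean_space \<Rightarrow> real"
  assumes "open S" "continuous_on S f" and nonneg: "AE x in lebesgue_on S. 0 \<le> f x" and "x \<in> S"
  shows "0 \<le> f x"
proof -
  have "AE x in lebesgue. x \<in> S \<longrightarrow> 0 \<le> f x"
    using nonneg \<open>open S\<close> by (subst (asm) AE_restrict_space_iff) auto
  then obtain N where "N \<in> null_sets lebesgue" "{x. \<not> (x \<in> S \<longrightarrow> 0 \<le> f x)} \<subseteq> N"
    by (auto simp: eventually_ae_filter)
  moreover have "S \<inter> f -` {..<0} = {x. \<not> (x \<in> S \<longrightarrow> 0 \<le> f x)}"
    by auto
  ultimately have "negligible (S \<inter> f -` {..<0})"
    by (metis negligible_iff_null_sets negligible_subset)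
  moreover have "open (S \<inter> f -` {..<0})"
    using assms by (intro continuous_open_preimage) auto
  ultimately have "S \<inter> f -` {..<0} = {}"
    using open_not_negligible by blast
  then show ?thesis
    using \<open>x \<in> S\<close> by force
qed

lemma nn_integral_norm_layers:
  fixes g :: "real \<Rightarrow> ennreal"
  assumes [measurable]: "g \<in> borel_measurable borel"
  shows "(\<integral>\<^sup>+h. (\<integral>\<^sup>+t\<in>{norm (h::'a::euclidean_space)..}. g t \<partial>lborel) \<partial>lborel)
    = (\<integral>\<^sup>+t\<in>{0..}. g t * ennreal (unit_ball_vol DIM('a) * t ^ DIM('a)) \<partial>lborel)"
proof -
  have "(\<integral>\<^sup>+h. (\<integral>\<^sup>+t\<in>{norm (h::'a)..}. g t \<partial>lborel) \<partial>lborel)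
      = (\<integral>\<^sup>+h. (\<integral>\<^sup>+t. g t * (if norm (h::'a) \<le> t then 1 else 0) \<partial>lborel) \<partial>lborel)"
    by (intro nn_integral_cong) (auto simp: indicator_def)
  also have "\<dots> = (\<integral>\<^sup>+t. (\<integral>\<^sup>+h. g t * (if norm (h::'a) \<le> t then 1 else 0) \<partial>lborel) \<partial>lborel)"
    by (rule lborel_pair.Fubini') measurable
  also have "\<dots> = (\<integral>\<^sup>+t. g t * ennreal (unit_ball_vol DIM('a) * t ^ DIM('a)) * indicator {0..} t \<partial>lborel)"
  proof (rule nn_integral_cong)
    fix t :: real
    have "(\<lambda>h::'a. g t * (if norm h \<le> t then 1 else 0)) = (\<lambda>h. g t * indicator (cball 0 t) h)"
      by (auto simp: indicator_def)
    then show "(\<integral>\<^sup>+h. g t * (if norm (h::'a) \<le> t then 1 else 0) \<partial>lborel)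
        = g t * ennreal (unit_ball_vol DIM('a) * t ^ DIM('a)) * indicator {0..} t"
      by (cases "0 \<le> t") (simp_all add: nn_integral_cmult_indicator emeasure_cball)
  qed
  finally show ?thesis .
qed

lemma nn_integral_min_one_power_powr_less_top:
  fixes e :: real
  assumes "e < -1" "-1 < real m + e"
  shows "(\<integral>\<^sup>+t\<in>{0..}. ennreal (min 1 (t ^ m) * t powr e) \<partial>lborel) < \<infinity>"
proof -
  have "(\<integral>\<^sup>+t\<in>{0..}. ennreal (min 1 (t ^ m) * t powr e) \<partial>lborel)
      \<le> (\<integral>\<^sup>+t. ennreal (t powr (real m + e)) * indicator {0..1} t
        + ennreal (t powr e) * indicator {1..} t \<partial>lborel)"
  proof (rule nn_integral_mono)
    fix t :: real
    show "ennreal (min 1 (t ^ m) * t powr e) * indicator {0..} t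
        \<le> ennreal (t powr (real m + e)) * indicator {0..1} t + ennreal (t powr e) * indicator {1..} t"
    proof (cases "0 < t \<and> t < 1")
      case True
      then have "min 1 (t ^ m) * t powr e \<le> t ^ m * t powr e"
        by (intro mult_right_mono) auto
      also have "\<dots> = t powr (real m + e)"
        using True by (simp add: powr_add powr_realpow)
      finally show ?thesis
        using True by (simp add: ennreal_leI)
    next
      case False
      then consider "t < 0" | "t = 0" | "1 \<le> t"
        by linarith
      then show ?thesis
        by cases (auto intro!: ennreal_leI add_increasing
            simp: mult_left_le_one_le min.coboundedI1 mult_left_le)
    qed
  qed
  also have "\<dots> = (\<integral>\<^sup>+t\<in>{0..1}. ennreal (t powr (real m + e)) \<partial>lborel)
      + (\<integral>\<^sup>+t\<in>{1..}. ennreal (t powr e) \<partial>lborel)"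
    by (rule nn_integral_add) measurable
  also have "\<dots> < \<infinity>"
    using nn_integral_has_integral_lebesgue'[OF _ has_integral_powr_from_0[OF assms(2), of 1]]
      nn_integral_has_integral_lebesgue'[OF _ has_integral_powr_to_inf[OF assms(1), of 1]]
    by simp
  finally show ?thesis .
qed

lemma min_one_power_powr_le_tail_integral:
  fixes a p :: real
  assumes "p < 0" "0 < a"
  shows "ennreal (min 1 (a ^ m) * a powr p)
    \<le> (\<integral>\<^sup>+t\<in>{a..}. ennreal (min 1 (t ^ m) * (- p * t powr (p - 1))) \<partial>lborel)"
proof -
  have tail_nonneg: "0 \<le> - p * t powr (p - 1)" for t
    using \<open>p < 0\<close> by (simp add: mult_nonpos_nonneg)
  have "((\<lambda>t. - p * t powr (p - 1)) has_integral a powr p) {a..}"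
    using has_integral_mult_right[OF has_integral_powr_to_inf[of "p - 1" a], of "- p"] assms by simp
  then have "ennreal (a powr p) = (\<integral>\<^sup>+t\<in>{a..}. ennreal (- p * t powr (p - 1)) \<partial>lborel)"
    using tail_nonneg by (intro nn_integral_has_integral_lebesgue'[symmetric])
  then have "ennreal (min 1 (a ^ m) * a powr p)
    = (\<integral>\<^sup>+t\<in>{a..}. ennreal (min 1 (a ^ m)) * ennreal (- p * t powr (p - 1)) \<partial>lborel)"
    using \<open>0 < a\<close> by (simp add: ennreal_mult nn_integral_cmult mult.assoc)
  also have "\<dots> \<le> (\<integral>\<^sup>+t\<in>{a..}. ennreal (min 1 (t ^ m) * (- p * t powr (p - 1))) \<partial>lborel)"
  proof (rule nn_integral_mono)
    fix t :: real
    have "min 1 (a ^ m) * (- p * t powr (p - 1)) \<le> min 1 (t ^ m) * (- p * t powr (p - 1))" if "a \<le> t"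
      using that \<open>0 < a\<close> tail_nonneg by (intro mult_right_mono min.mono power_mono) auto
    then show "ennreal (min 1 (a ^ m)) * ennreal (- p * t powr (p - 1)) * indicator {a..} t
        \<le> ennreal (min 1 (t ^ m) * (- p * t powr (p - 1))) * indicator {a..} t"
      using \<open>0 < a\<close> tail_nonneg[of t]
      by (subst ennreal_mult[symmetric]) (auto simp: indicator_def intro!: ennreal_leI)
  qed
  finally show ?thesis .
qed

lemma integrable_min_one_power_norm_powr:
  assumes p: "p < - real DIM('a)" "- real DIM('a) < real m + p"
  shows "integrable lborel (\<lambda>h::'a::euclidean_space. min 1 (norm h ^ m) * norm h powr p)"
proof (rule integrableI_nonneg)
  define V where "V = unit_ball_vol (real DIM('a))"
  define g where "g t = ennreal (min 1 (t ^ m) * (- p * t powr (p - 1)))" for t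
  have [measurable]: "g \<in> borel_measurable borel"
    unfolding g_def by measurable
  have "p < 0"
    using p(1) by (rule less_le_trans) simp
  have "ennreal (min 1 (norm h ^ m) * norm h powr p) \<le> (\<integral>\<^sup>+t\<in>{norm h..}. g t \<partial>lborel)" for h :: 'a
    unfolding g_def using min_one_power_powr_le_tail_integral[OF \<open>p < 0\<close>, of "norm h" m]
    by (cases "h = 0") simp_all
  then have "(\<integral>\<^sup>+h. ennreal (min 1 (norm (h::'a) ^ m) * norm h powr p) \<partial>lborel)
      \<le> (\<integral>\<^sup>+h. (\<integral>\<^sup>+t\<in>{norm (h::'a)..}. g t \<partial>lborel) \<partial>lborel)"
    by (intro nn_integral_mono)
  also have "\<dots> = (\<integral>\<^sup>+t\<in>{0..}. g t * ennreal (V * t ^ DIM('a)) \<partial>lborel)"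
    unfolding V_def by (rule nn_integral_norm_layers) measurable
  also have "\<dots> = (\<integral>\<^sup>+t. ennreal (- p) * ennreal V *
      (ennreal (min 1 (t ^ m) * t powr (p - 1 + DIM('a))) * indicator {0..} t) \<partial>lborel)"
    using \<open>p < 0\<close>
    by (intro nn_integral_cong)
      (auto simp: g_def V_def indicator_def powr_add powr_realpow' ennreal_mult mult_nonpos_nonneg ac_simps
        simp flip: ennreal_mult)
  also have "\<dots> = ennreal (- p) * ennreal V *
      (\<integral>\<^sup>+t\<in>{0..}. ennreal (min 1 (t ^ m) * t powr (p - 1 + DIM('a))) \<partial>lborel)"
    by (rule nn_integral_cmult) measurable
  also have "\<dots> < \<infinity>"
    using nn_integral_min_one_power_powr_less_top[of "p - 1 + DIM('a)" m] p
    by (simp add: ennreal_mult_less_top)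
  finally show "(\<integral>\<^sup>+h. ennreal (min 1 (norm (h::'a) ^ m) * norm h powr p) \<partial>lborel) < \<infinity>" .
qed auto

subsection \<open>Twice continuously differentiable functions\<close>

lemma grad_inner_Basis:
  assumes "b \<in> Basis"
  shows "grad f x \<bullet> b = d1 f b x"
  using assms by (simp add: grad_def d1_def)

lemma inner_grad_eq_sum_d1: "grad f x \<bullet> v = (\<Sum>b\<in>Basis. (v \<bullet> b) * d1 f b x)"
  by (subst euclidean_inner) (simp add: grad_inner_Basis mult.commute)

lemma grad_eqI:
  assumes "(f has_derivative (\<lambda>v. g \<bullet> v)) (at x)"
  shows "grad f x = g"
  by (simp add: grad_def frechet_derivative_at[OF assms, symmetric] euclidean_representation)

lemma has_derivative_grad:
  assumes "f differentiable (at x)"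
  shows "(f has_derivative (\<lambda>v. grad f x \<bullet> v)) (at x)"
proof -
  have deriv: "(f has_derivative frechet_derivative f (at x)) (at x)"
    using assms frechet_derivative_works by blast
  have "frechet_derivative f (at x) v = grad f x \<bullet> v" for v
  proof -
    have "frechet_derivative f (at x) (\<Sum>b\<in>Basis. (v \<bullet> b) *\<^sub>R b) = (\<Sum>b\<in>Basis. (v \<bullet> b) * d1 f b x)"
      using linear_frechet_derivative[OF assms] by (simp add: linear_sum linear_scale d1_def)
    then show ?thesis
      by (simp add: euclidean_representation inner_grad_eq_sum_d1)
  qed
  then have "frechet_derivative f (at x) = (\<lambda>v. grad f x \<bullet> v)"
    by blast
  with deriv show ?thesis
    by metis
qed

lemma frechet_derivative_eq_inner_grad:
  assumes "f differentiable (at x)"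
  shows "frechet_derivative f (at x) v = grad f x \<bullet> v"
  using frechet_derivative_at[OF has_derivative_grad[OF assms]] by metis

lemma has_real_derivative_along_line:
  assumes "f differentiable (at (x + t *\<^sub>R v))"
  shows "((\<lambda>t. f (x + t *\<^sub>R v)) has_real_derivative grad f (x + t *\<^sub>R v) \<bullet> v) (at t)"
proof -
  have "((\<lambda>t. x + t *\<^sub>R v) has_derivative (\<lambda>h. h *\<^sub>R v)) (at t)"
    by (auto intro!: derivative_eq_intros)
  from has_derivative_compose[OF this has_derivative_grad[OF assms]] show ?thesis
    by (simp add: has_field_derivative_def mult_commute_abs)
qed

definition hessian_form :: "('a::euclidean_space \<Rightarrow> real) \<Rightarrow> 'a \<Rightarrow> 'a \<Rightarrow> real" where
  "hessian_form f x v = (\<Sum>b\<in>Basis. \<Sum>c\<in>Basis. (v \<bullet> b) * (v \<bullet> c) * d2 f b c x)"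

lemma hessian_form_Basis:
  assumes "b \<in> Basis"
  shows "hessian_form f x b = d2 f b b x"
proof -
  have "(\<Sum>c\<in>Basis. (b \<bullet> c) * k c) = k b" for k :: "'a \<Rightarrow> real"
    using assms by (simp add: inner_Basis if_distrib[of "\<lambda>a. a * _"] cong: if_cong)
  then show ?thesis
    by (simp add: hessian_form_def mult.assoc flip: sum_distrib_left)
qed

lemma laplacian_eq_sum_hessian_form: "laplacian f x = (\<Sum>b\<in>Basis. hessian_form f x b)"
  by (simp add: laplacian_def hessian_form_Basis)

lemma abs_hessian_form_le:
  "\<bar>hessian_form f x v\<bar> \<le> (\<Sum>b\<in>Basis. \<Sum>c\<in>Basis. \<bar>d2 f b c x\<bar>) * (norm v)\<^sup>2"
proof -
  have "\<bar>hessian_form f x v\<bar> \<le> (\<Sum>b\<in>Basis. \<Sum>c\<in>Basis. \<bar>(v \<bullet> b) * (v \<bullet> c) * d2 f b c x\<bar>)"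
    unfolding hessian_form_def by (intro sum_abs[THEN order_trans] sum_mono) auto
  also have "\<dots> \<le> (\<Sum>b\<in>Basis. \<Sum>c\<in>Basis. norm v * norm v * \<bar>d2 f b c x\<bar>)"
    unfolding abs_mult by (intro sum_mono mult_right_mono mult_mono) (auto simp: Basis_le_norm)
  finally show ?thesis
    by (simp add: sum_distrib_left power2_eq_square mult.commute)
qed

lemma C2_on_has_real_derivative_grad_along_line:
  assumes "C2_on S f" "x + t *\<^sub>R v \<in> S"
  shows "((\<lambda>t. grad f (x + t *\<^sub>R v) \<bullet> v) has_real_derivative hessian_form f (x + t *\<^sub>R v) v) (at t)"
proof -
  have "((\<lambda>t. d1 f b (x + t *\<^sub>R v)) has_real_derivative (\<Sum>c\<in>Basis. (v \<bullet> c) * d2 f b c (x + t *\<^sub>R v))) (at t)"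
    if "b \<in> Basis" for b
  proof -
    have "d1 f b differentiable (at (x + t *\<^sub>R v))"
      using assms that by (simp add: C2_on_def)
    from has_real_derivative_along_line[OF this] show ?thesis
      by (simp add: inner_grad_eq_sum_d1 d2_def d1_def[of "d1 f b"])
  qed
  then have "((\<lambda>t. \<Sum>b\<in>Basis. (v \<bullet> b) * d1 f b (x + t *\<^sub>R v)) has_real_derivative
      (\<Sum>b\<in>Basis. (v \<bullet> b) * (\<Sum>c\<in>Basis. (v \<bullet> c) * d2 f b c (x + t *\<^sub>R v)))) (at t)"
    by (intro DERIV_sum DERIV_cmult)
  then show ?thesis
    by (simp add: inner_grad_eq_sum_d1 hessian_form_def sum_distrib_left mult.assoc)
qed

lemma C2_on_continuous_on_grad:
  assumes "C2_on S f"
  shows "continuous_on S (grad f)"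
proof -
  have "continuous_on S (d1 f b)" if "b \<in> Basis" for b
    using assms that unfolding C2_on_def
    by (intro continuous_at_imp_continuous_on) (auto intro: differentiable_imp_continuous_within)
  then show ?thesis
    unfolding grad_def d1_def[symmetric] by (intro continuous_intros)
qed

lemma C2_on_Taylor:
  assumes C2: "C2_on S f" and seg: "closed_segment x y \<subseteq> S"
  obtains z where "z \<in> closed_segment x y"
    "f y = f x + grad f x \<bullet> (y - x) + hessian_form f z (y - x) / 2"
proof -
  define v where "v = y - x"
  define deriv where
    "deriv m t = (if m = 0 then f (x + t *\<^sub>R v) else if m = 1 then grad f (x + t *\<^sub>R v) \<bullet> v
       else hessian_form f (x + t *\<^sub>R v) v)" for m :: nat and t
  have in_seg: "x + t *\<^sub>R v \<in> closed_segment x y" if "0 \<le> t" "t \<le> 1" for t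
    using that unfolding v_def closed_segment_def by (auto simp: algebra_simps intro!: exI[of _ t])
  have "(deriv m has_real_derivative deriv (Suc m) t) (at t)" if "m < 2" "0 \<le> t" "t \<le> 1" for m t
  proof -
    have "x + t *\<^sub>R v \<in> S"
      using in_seg that seg by blast
    moreover from this have "f differentiable (at (x + t *\<^sub>R v))"
      using C2 by (simp add: C2_on_def)
    moreover have "m = 0 \<or> m = 1"
      using \<open>m < 2\<close> by linarith
    ultimately show ?thesis
      unfolding deriv_def
      using C2_on_has_real_derivative_grad_along_line[OF C2] has_real_derivative_along_line by auto
  qed
  then have "\<exists>t. 0 < t \<and> t < 1 \<and>
      deriv 0 1 = (\<Sum>m<2. deriv m 0 / fact m * (1 - 0) ^ m) + deriv 2 t / fact 2 * (1 - 0)\<^sup>2"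
    by (intro Taylor_up[where a = 0]) auto
  then obtain t where "0 < t" "t < 1" "f y = f x + grad f x \<bullet> v + hessian_form f (x + t *\<^sub>R v) v / 2"
    by (auto simp: deriv_def numeral_2_eq_2 v_def)
  then show thesis
    using that[of "x + t *\<^sub>R v"] in_seg[of t] by (simp add: v_def)
qed

lemma C2_on_Taylor_bound:
  assumes C2: "C2_on S f" and K: "compact K" "convex K" "K \<subseteq> S"
  obtains M where "0 \<le> M"
    "\<And>x y. x \<in> K \<Longrightarrow> y \<in> K \<Longrightarrow> \<bar>f y - f x - grad f x \<bullet> (y - x)\<bar> \<le> M * (norm (y - x))\<^sup>2"
proof -
  define H where "H x = (\<Sum>b\<in>Basis. \<Sum>c\<in>Basis. \<bar>d2 f b c x\<bar>)" for x
  have "continuous_on K H"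
    unfolding H_def using C2 K(3)
    by (intro continuous_intros) (meson C2_on_def continuous_on_subset)
  then have "bounded (H ` K)"
    using K(1) by (intro compact_imp_bounded compact_continuous_image)
  then obtain M where M: "0 < M" "\<And>x. x \<in> K \<Longrightarrow> H x \<le> M"
    unfolding bounded_pos by (auto dest: abs_le_D1)
  have "\<bar>f y - f x - grad f x \<bullet> (y - x)\<bar> \<le> M * (norm (y - x))\<^sup>2" if "x \<in> K" "y \<in> K" for x y
  proof -
    have "closed_segment x y \<subseteq> K"
      using that K(2) by (rule closed_segment_subset)
    then obtain z where z: "z \<in> K" "f y = f x + grad f x \<bullet> (y - x) + hessian_form f z (y - x) / 2"
      using C2_on_Taylor[OF C2, of x y] K(3) by blast
    have "\<bar>hessian_form f z (y - x)\<bar> \<le> H z * (norm (y - x))\<^sup>2"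
      unfolding H_def by (rule abs_hessian_form_le)
    also have "\<dots> \<le> M * (norm (y - x))\<^sup>2"
      using M(2)[OF z(1)] by (intro mult_right_mono) auto
    finally show ?thesis
      using z(2) by simp
  qed
  then show thesis
    using that M(1) by (meson less_imp_le)
qed

lemma derivatives_at_local_min:
  fixes f f' :: "real \<Rightarrow> real"
  assumes "0 < \<delta>"
    and f: "\<And>t. \<bar>t\<bar> < \<delta> \<Longrightarrow> (f has_real_derivative f' t) (at t)"
    and f': "(f' has_real_derivative m) (at 0)"
    and min: "\<And>t. \<bar>t\<bar> < \<delta> \<Longrightarrow> f 0 \<le> f t"
  shows "f' 0 = 0" "0 \<le> m"
proof -
  show "f' 0 = 0"
    using DERIV_local_min[OF f[of 0] \<open>0 < \<delta>\<close>] \<open>0 < \<delta>\<close> min by auto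
  show "0 \<le> m"
  proof (rule ccontr)
    assume "\<not> 0 \<le> m"
    then obtain d where d: "0 < d" "\<And>h. 0 < h \<Longrightarrow> h < d \<Longrightarrow> f' h < 0"
      using has_real_derivative_neg_dec_right[OF f'] \<open>f' 0 = 0\<close> by force
    define t where "t = min d \<delta> / 2"
    have t: "0 < t" "t < d" "t < \<delta>"
      using d \<open>0 < \<delta>\<close> by (auto simp: t_def min_def)
    obtain \<tau> where \<tau>: "0 < \<tau>" "\<tau> < t" "f t - f 0 = (t - 0) * f' \<tau>"
      using MVT2[of 0 t f f'] t f by force
    then have "t * f' \<tau> < 0"
      using d t by (intro mult_pos_neg) auto
    then show False
      using \<tau> min[of t] t by simp
  qed
qed

lemma C2_on_touching_below:
  assumes S: "open S" "x \<in> S" and f: "C2_on S f" and g: "C2_on S g"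
    and min: "\<And>y. y \<in> S \<Longrightarrow> f x - g x \<le> f y - g y"
  shows "grad f x = grad g x" "laplacian g x \<le> laplacian f x"
proof -
  have "grad f x \<bullet> v = grad g x \<bullet> v \<and> hessian_form g x v \<le> hessian_form f x v" for v
  proof -
    have "\<forall>\<^sub>F t in nhds 0. x + t *\<^sub>R v \<in> S"
      using S by (intro topological_tendstoD[of _ x]) (auto intro!: tendsto_eq_intros filterlim_ident)
    then obtain \<delta> where \<delta>: "0 < \<delta>" "\<And>t. \<bar>t\<bar> < \<delta> \<Longrightarrow> x + t *\<^sub>R v \<in> S"
      by (auto simp: eventually_nhds_metric dist_norm)
    define \<phi> where "\<phi> t = f (x + t *\<^sub>R v) - g (x + t *\<^sub>R v)" for t
    define \<phi>' where "\<phi>' t = grad f (x + t *\<^sub>R v) \<bullet> v - grad g (x + t *\<^sub>R v) \<bullet> v" for t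
    have "(\<phi> has_real_derivative \<phi>' t) (at t)" if "\<bar>t\<bar> < \<delta>" for t
      unfolding \<phi>_def \<phi>'_def using \<delta>(2)[OF that] f g
      by (intro DERIV_diff has_real_derivative_along_line) (auto simp: C2_on_def)
    moreover have "(\<phi>' has_real_derivative (hessian_form f x v - hessian_form g x v)) (at 0)"
      unfolding \<phi>'_def using S(2)
        C2_on_has_real_derivative_grad_along_line[OF f, of x 0 v]
        C2_on_has_real_derivative_grad_along_line[OF g, of x 0 v]
      by (intro DERIV_diff) auto
    moreover have "\<phi> 0 \<le> \<phi> t" if "\<bar>t\<bar> < \<delta>" for t
      using min \<delta>(2)[OF that] by (simp add: \<phi>_def)
    ultimately have "\<phi>' 0 = 0" "0 \<le> hessian_form f x v - hessian_form g x v"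
      using derivatives_at_local_min[OF \<delta>(1), of \<phi> \<phi>'] by blast+
    then show ?thesis
      by (simp add: \<phi>'_def)
  qed
  then show "grad f x = grad g x" "laplacian g x \<le> laplacian f x"
    unfolding laplacian_eq_sum_hessian_form by (auto intro: euclidean_eqI sum_mono)
qed

subsection \<open>The Gaussian barrier\<close>

definition gaussian :: "real \<Rightarrow> real \<Rightarrow> 'a::euclidean_space \<Rightarrow> 'a \<Rightarrow> real" where
  "gaussian A \<alpha> y x = A * exp (- \<alpha> * (norm (x - y))\<^sup>2)"

lemma gaussian_pos: "0 < A \<Longrightarrow> 0 < gaussian A \<alpha> y x"
  by (simp add: gaussian_def)

lemma has_derivative_gaussian:
  "(gaussian A \<alpha> y has_derivative (\<lambda>v. (- 2 * \<alpha> * gaussian A \<alpha> y x) *\<^sub>R (x - y) \<bullet> v)) (at x)"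
  unfolding gaussian_def[abs_def] power2_norm_eq_inner
  by (auto intro!: derivative_eq_intros simp: algebra_simps inner_commute)

lemma grad_gaussian: "grad (gaussian A \<alpha> y) x = (- 2 * \<alpha> * gaussian A \<alpha> y x) *\<^sub>R (x - y)"
  by (rule grad_eqI) (rule has_derivative_gaussian)

lemma d1_gaussian:
  assumes "b \<in> Basis"
  shows "d1 (gaussian A \<alpha> y) b = (\<lambda>x. - 2 * \<alpha> * ((x - y) \<bullet> b) * gaussian A \<alpha> y x)"
  by (rule ext) (simp add: assms grad_gaussian flip: grad_inner_Basis)

lemma has_derivative_d1_gaussian:
  assumes "b \<in> Basis"
  shows "(d1 (gaussian A \<alpha> y) b has_derivative (\<lambda>v. gaussian A \<alpha> y x *
    (4 * \<alpha>\<^sup>2 * ((x - y) \<bullet> b) * ((x - y) \<bullet> v) - 2 * \<alpha> * (b \<bullet> v)))) (at x)"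
  unfolding d1_gaussian[OF assms]
  by (auto intro!: derivative_eq_intros has_derivative_gaussian
      simp: power2_eq_square algebra_simps inner_commute)

lemma d2_gaussian:
  assumes "b \<in> Basis"
  shows "d2 (gaussian A \<alpha> y) b c x =
    gaussian A \<alpha> y x * (4 * \<alpha>\<^sup>2 * ((x - y) \<bullet> b) * ((x - y) \<bullet> c) - 2 * \<alpha> * (b \<bullet> c))"
  unfolding d2_def by (subst frechet_derivative_at[OF has_derivative_d1_gaussian[OF assms], symmetric]) simp

lemma C2_on_gaussian: "C2_on S (gaussian A \<alpha> y)"
proof -
  have "continuous_on S (d2 (gaussian A \<alpha> y) b c)" if "b \<in> Basis" for b c
    unfolding d2_gaussian[OF that, abs_def] gaussian_def by (intro continuous_intros)
  then show ?thesis
    unfolding C2_on_def differentiable_def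
    using has_derivative_gaussian has_derivative_d1_gaussian by blast
qed

lemma laplacian_gaussian:
  fixes x y :: "'a::euclidean_space"
  shows "laplacian (gaussian A \<alpha> y) x =
    gaussian A \<alpha> y x * (4 * \<alpha>\<^sup>2 * (norm (x - y))\<^sup>2 - 2 * \<alpha> * DIM('a))"
proof -
  have "laplacian (gaussian A \<alpha> y) x =
      gaussian A \<alpha> y x * (\<Sum>b\<in>Basis. 4 * \<alpha>\<^sup>2 * ((x - y) \<bullet> b)\<^sup>2 - 2 * \<alpha>)"
    by (simp add: laplacian_def d2_gaussian sum_distrib_left power2_eq_square mult.assoc)
  also have "(\<Sum>b\<in>Basis. 4 * \<alpha>\<^sup>2 * ((x - y) \<bullet> b)\<^sup>2 - 2 * \<alpha>)
      = 4 * \<alpha>\<^sup>2 * (\<Sum>b\<in>Basis. ((x - y) \<bullet> b)\<^sup>2) - 2 * \<alpha> * DIM('a)"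
    by (simp add: sum_subtractf sum_distrib_left)
  also have "(\<Sum>b\<in>Basis. ((x - y) \<bullet> b)\<^sup>2) = (norm (x - y))\<^sup>2"
    unfolding power2_norm_eq_inner by (subst euclidean_inner) (simp add: power2_eq_square)
  finally show ?thesis .
qed

definition second_diff :: "('a::real_vector \<Rightarrow> real) \<Rightarrow> 'a \<Rightarrow> 'a \<Rightarrow> real" where
  "second_diff u x h = 2 * u x - u (x + h) - u (x - h)"

lemma second_diff_gaussian_le:
  assumes "0 \<le> A" "0 \<le> \<alpha>"
  shows "second_diff (gaussian A \<alpha> y) x h \<le> 2 * \<alpha> * gaussian A \<alpha> y x * (norm h)\<^sup>2"
proof -
  have "gaussian A \<alpha> y x * (1 + (- 2 * \<alpha> * ((x - y) \<bullet> k) - \<alpha> * (norm k)\<^sup>2)) \<le> gaussian A \<alpha> y (x + k)" for k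
  proof -
    have "- \<alpha> * (norm (x + k - y))\<^sup>2
        = - \<alpha> * (norm (x - y))\<^sup>2 + (- 2 * \<alpha> * ((x - y) \<bullet> k) - \<alpha> * (norm k)\<^sup>2)"
      by (simp add: power2_norm_eq_inner inner_simps inner_commute algebra_simps)
    then have "gaussian A \<alpha> y (x + k)
        = gaussian A \<alpha> y x * exp (- 2 * \<alpha> * ((x - y) \<bullet> k) - \<alpha> * (norm k)\<^sup>2)"
      by (simp only: gaussian_def exp_add mult.assoc)
    moreover have "0 \<le> gaussian A \<alpha> y x"
      using \<open>0 \<le> A\<close> by (simp add: gaussian_def)
    ultimately show ?thesis
      using mult_left_mono[OF exp_ge_add_one_self] by simp
  qed
  from this[of h] this[of "- h"] show ?thesis
    by (simp add: second_diff_def algebra_simps)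
qed

definition gaussian_barrier :: "real \<Rightarrow> real \<Rightarrow> 'a::euclidean_space \<Rightarrow> real \<Rightarrow> 'a \<Rightarrow> real" where
  "gaussian_barrier A \<alpha> y r x = gaussian A \<alpha> y x - A * exp (- \<alpha> * r\<^sup>2)"

lemma gaussian_barrier_le:
  assumes "0 \<le> A" "0 \<le> \<alpha>"
  shows "gaussian_barrier A \<alpha> y r x \<le> A"
proof -
  have "gaussian A \<alpha> y x \<le> A"
    unfolding gaussian_def using assms by (intro mult_left_le) auto
  moreover have "0 \<le> A * exp (- \<alpha> * r\<^sup>2)"
    using assms by simp
  ultimately show ?thesis
    unfolding gaussian_barrier_def by linarith
qed

lemma gaussian_barrier_nonpos:
  assumes "0 \<le> A" "0 \<le> \<alpha>" "0 \<le> r" "x \<notin> ball y r"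
  shows "gaussian_barrier A \<alpha> y r x \<le> 0"
proof -
  have "r\<^sup>2 \<le> (norm (x - y))\<^sup>2"
    using assms by (intro power_mono) (auto simp: dist_norm norm_minus_commute)
  then show ?thesis
    using assms by (simp add: gaussian_barrier_def gaussian_def mult_left_mono)
qed

lemma gaussian_barrier_ge_linear:
  assumes "0 \<le> A" "0 \<le> \<alpha>" "0 \<le> t" "t \<le> r" and "norm (x - y) = r - t"
  shows "A * exp (- \<alpha> * r\<^sup>2) * \<alpha> * r * t \<le> gaussian_barrier A \<alpha> y r x"
proof -
  have "\<alpha> * (r * t) \<le> \<alpha> * (r\<^sup>2 - (r - t)\<^sup>2)"
    using assms by (intro mult_left_mono) (auto simp: power2_eq_square algebra_simps mult_right_mono)
  also have "\<dots> \<le> exp (\<alpha> * (r\<^sup>2 - (r - t)\<^sup>2)) - 1"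
    using exp_ge_add_one_self[of "\<alpha> * (r\<^sup>2 - (r - t)\<^sup>2)"] by linarith
  finally have "A * exp (- \<alpha> * r\<^sup>2) * (\<alpha> * (r * t))
      \<le> A * exp (- \<alpha> * r\<^sup>2) * (exp (\<alpha> * (r\<^sup>2 - (r - t)\<^sup>2)) - 1)"
    using \<open>0 \<le> A\<close> by (intro mult_left_mono) auto
  also have "\<dots> = A * exp (- \<alpha> * (r - t)\<^sup>2) - A * exp (- \<alpha> * r\<^sup>2)"
    by (simp add: algebra_simps flip: exp_add)
  finally show ?thesis
    by (simp add: gaussian_barrier_def gaussian_def assms(5) mult.assoc)
qed

lemma gaussian_barrier_touching_point:
  fixes f :: "'a::euclidean_space \<Rightarrow> real"
  assumes cont: "continuous_on (cball y r) f" and ge: "\<And>x. c \<le> f x"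
    and nonneg: "0 \<le> A" "0 \<le> \<alpha>"
    and x: "x \<in> ball y r" "f x < c + gaussian_barrier A \<alpha> y r x"
  obtains w where "w \<in> ball y r" "f w < c + gaussian_barrier A \<alpha> y r w"
    "\<And>z. f w - gaussian A \<alpha> y w \<le> f z - gaussian A \<alpha> y z"
proof -
  have "0 \<le> r"
    using x(1) zero_le_dist[of y x] unfolding mem_ball by linarith
  have "continuous_on (cball y r) (\<lambda>x. f x - gaussian_barrier A \<alpha> y r x)"
    unfolding gaussian_barrier_def gaussian_def by (intro continuous_intros cont)
  then have "\<exists>w\<in>cball y r. \<forall>z\<in>cball y r.
      f w - gaussian_barrier A \<alpha> y r w \<le> f z - gaussian_barrier A \<alpha> y r z"
    using \<open>0 \<le> r\<close> by (intro continuous_attains_inf) auto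
  then obtain w where w: "\<And>z. z \<in> cball y r \<Longrightarrow>
      f w - gaussian_barrier A \<alpha> y r w \<le> f z - gaussian_barrier A \<alpha> y r z"
    by blast
  have below: "f w - gaussian_barrier A \<alpha> y r w < c"
    using w[of x] x by simp
  have outside: "c \<le> f z - gaussian_barrier A \<alpha> y r z" if "z \<notin> ball y r" for z
    using gaussian_barrier_nonpos[OF nonneg \<open>0 \<le> r\<close> that] ge[of z] by force
  have "w \<in> ball y r"
    using below outside[of w] by linarith
  moreover have "f w - gaussian A \<alpha> y w \<le> f z - gaussian A \<alpha> y z" for z
    using w[of z] below outside[of z] by (cases "z \<in> ball y r") (auto simp: gaussian_barrier_def)
  ultimately show thesis
    using that below by (simp add: less_diff_eq)
qed

lemma touching_coefficient_neg:
  fixes \<alpha> r \<rho> B C :: real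
  assumes "0 \<le> r" "r / 2 \<le> \<rho>" "\<rho> \<le> r" "0 \<le> \<alpha>" "0 \<le> C" "B + 2 * C * r < \<alpha> * r\<^sup>2"
  shows "B + 2 * C * \<rho> - 4 * \<alpha> * \<rho>\<^sup>2 < 0"
proof -
  have "(r / 2)\<^sup>2 \<le> \<rho>\<^sup>2"
    using assms by (intro power_mono) auto
  then have "\<alpha> * r\<^sup>2 \<le> 4 * \<alpha> * \<rho>\<^sup>2"
    using mult_left_mono[of "r\<^sup>2" "4 * \<rho>\<^sup>2" \<alpha>] \<open>0 \<le> \<alpha>\<close> by (simp add: power_divide)
  moreover have "2 * C * \<rho> \<le> 2 * C * r"
    using assms by (intro mult_left_mono) auto
  ultimately show ?thesis
    using assms(6) by linarith
qed

lemma inward_normal_in_ball: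
  fixes \<nu> :: "'a::real_normed_vector"
  assumes "norm \<nu> = 1" "0 < t" "t < r"
  shows "x - t *\<^sub>R \<nu> \<in> ball (x - r *\<^sub>R \<nu>) r"
  using assms by (simp add: dist_norm flip: scaleR_diff_left)

subsection \<open>The fractional Laplacian as an integral of second differences\<close>

definition frac_kernel :: "real \<Rightarrow> 'a::euclidean_space \<Rightarrow> real" where
  "frac_kernel s h = 1 / norm h powr (real DIM('a) + 2 * s)"

lemma frac_kernel_nonneg [simp]: "0 \<le> frac_kernel s h"
  by (simp add: frac_kernel_def)

lemma measurable_frac_kernel [measurable]: "frac_kernel s \<in> borel_measurable borel"
  unfolding frac_kernel_def by measurable

lemma frac_const_pos:
  assumes "0 < s" "s < 1"
  shows "0 < frac_const N s"
  using assms unfolding frac_const_def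
  by (intro divide_pos_pos mult_pos_pos Gamma_real_pos add_nonneg_pos) auto

lemma integrable_min_one_norm2_frac_kernel:
  assumes "0 < s" "s < 1"
  shows "integrable lborel (\<lambda>h::'a::euclidean_space. min 1 ((norm h)\<^sup>2) * frac_kernel s h)"
  unfolding frac_kernel_def powr_minus_divide[symmetric]
  using assms by (intro integrable_min_one_power_norm_powr) auto

lemma integrable_mult_frac_kernel:
  fixes f :: "'a::euclidean_space \<Rightarrow> real"
  assumes s: "0 < s" "s < 1" and meas: "f \<in> borel_measurable borel"
    and bound: "\<And>h. \<bar>f h\<bar> \<le> M * min 1 ((norm h)\<^sup>2)"
  shows "integrable lborel (\<lambda>h. f h * frac_kernel s h)"
proof (rule Bochner_Integration.integrable_bound)
  show "integrable lborel (\<lambda>h::'a. M * (min 1 ((norm h)\<^sup>2) * frac_kernel s h))"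
    using integrable_min_one_norm2_frac_kernel[OF s] by (rule integrable_mult_right)
  have "norm (f h * frac_kernel s h) \<le> norm (M * (min 1 ((norm h)\<^sup>2) * frac_kernel s h))" for h
  proof -
    have "\<bar>f h\<bar> \<le> \<bar>M * min 1 ((norm h)\<^sup>2)\<bar>"
      using bound[of h] by linarith
    then have "\<bar>f h\<bar> * frac_kernel s h \<le> \<bar>M * min 1 ((norm h)\<^sup>2)\<bar> * frac_kernel s h"
      by (rule mult_right_mono) simp
    then show ?thesis
      by (simp add: abs_mult mult.assoc)
  qed
  then show "AE h in lborel. norm (f h * frac_kernel s h)
      \<le> norm (M * (min 1 ((norm h)\<^sup>2) * frac_kernel s h))"
    by simp
qed (use meas in measurable)

lemma le_mult_min_one_power2:
  fixes a t :: real
  assumes "0 < \<delta>" "0 \<le> B" "0 \<le> K" "0 \<le> t" and global: "a \<le> B" and local: "t \<le> \<delta> \<Longrightarrow> a \<le> K * t\<^sup>2"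
  shows "a \<le> (B + K + B / \<delta>\<^sup>2) * min 1 (t\<^sup>2)"
proof -
  have "a \<le> (B + K + B / \<delta>\<^sup>2) * 1"
    using assms by (simp add: add_increasing2)
  moreover have "a \<le> (B + K + B / \<delta>\<^sup>2) * t\<^sup>2"
  proof (cases "t \<le> \<delta>")
    case True
    then have "a \<le> K * t\<^sup>2"
      by (rule local)
    also have "\<dots> \<le> (B + K + B / \<delta>\<^sup>2) * t\<^sup>2"
      using assms(1-3) by (intro mult_right_mono) auto
    finally show ?thesis .
  next
    case False
    have "a \<le> B / \<delta>\<^sup>2 * \<delta>\<^sup>2"
      using assms(1) global by simp
    also have "\<dots> \<le> (B + K + B / \<delta>\<^sup>2) * t\<^sup>2"
      using False assms(1-3) by (intro mult_mono power_mono) auto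
    finally show ?thesis .
  qed
  ultimately show ?thesis
    by (simp add: min_def)
qed

text \<open>The supremum of the operator \<open>- \<Delta> + (- \<Delta>)\<^sup>s + q \<cdot> \<nabla>\<close> over all drifts with \<open>|q| \<le> C\<close>.\<close>
definition extremal_operator :: "real \<Rightarrow> real \<Rightarrow> ('a::euclidean_space \<Rightarrow> real) \<Rightarrow> 'a \<Rightarrow> real" where
  "extremal_operator s C u x = - laplacian u x + frac_lap s u x + C * norm (grad u x)"

locale frac_lap_regular =
  fixes s :: real and \<Omega> :: "'a::euclidean_space set" and u :: "'a \<Rightarrow> real"
  assumes s_pos: "0 < s" and s_less_1: "s < 1"
    and open_\<Omega>: "open \<Omega>"
    and C2: "C2_on \<Omega> u"
    and cont: "continuous_on UNIV u"
    and bounded_range: "bounded (range u)"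
begin

lemma isCont_u: "isCont u x"
  using cont by (simp add: continuous_on_eq_continuous_at)

lemma measurable_u [measurable]: "u \<in> borel_measurable borel"
  using cont by (rule borel_measurable_continuous_onI)

lemma differentiable_u: "x \<in> \<Omega> \<Longrightarrow> u differentiable (at x)"
  using C2 by (simp add: C2_on_def)

lemma measurable_second_diff [measurable]: "second_diff u x \<in> borel_measurable borel"
  unfolding second_diff_def by measurable

lemma bound_u:
  obtains B where "0 \<le> B" "\<And>x. \<bar>u x\<bar> \<le> B"
  using bounded_range unfolding bounded_pos by (auto intro: less_imp_le)

lemma second_diff_bound:
  assumes "z \<in> \<Omega>"
  obtains M where "\<forall>\<^sub>F x in nhds z. \<forall>h. \<bar>second_diff u x h\<bar> \<le> M * min 1 ((norm h)\<^sup>2)"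
proof -
  obtain B where B: "0 \<le> B" "\<And>x. \<bar>u x\<bar> \<le> B"
    using bound_u by blast
  obtain e where e: "0 < e" "cball z e \<subseteq> \<Omega>"
    using \<open>z \<in> \<Omega>\<close> open_\<Omega> open_contains_cball by blast
  obtain K where K: "0 \<le> K" "\<And>x y. x \<in> cball z e \<Longrightarrow> y \<in> cball z e \<Longrightarrow>
      \<bar>u y - u x - grad u x \<bullet> (y - x)\<bar> \<le> K * (norm (y - x))\<^sup>2"
    using C2_on_Taylor_bound[OF C2, of "cball z e"] e(2) by auto
  define \<delta> where "\<delta> = e / 2"
  have \<delta>: "0 < \<delta>" "\<delta> + \<delta> = e"
    using e by (simp_all add: \<delta>_def)
  have "\<bar>second_diff u x h\<bar> \<le> (4 * B + 2 * K + 4 * B / \<delta>\<^sup>2) * min 1 ((norm h)\<^sup>2)"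
    if x: "x \<in> ball z \<delta>" for x h
  proof (rule le_mult_min_one_power2)
    show "\<bar>second_diff u x h\<bar> \<le> 4 * B"
      using B(2)[of x] B(2)[of "x + h"] B(2)[of "x - h"] unfolding second_diff_def by linarith
    assume h: "norm h \<le> \<delta>"
    have "x \<in> cball z e" "x + h \<in> cball z e" "x - h \<in> cball z e"
      using x h \<delta> norm_triangle_ineq4[of "z - x" h] norm_triangle_ineq[of "z - x" h]
      by (simp_all add: dist_norm algebra_simps)
    then have "\<bar>u (x + h) - u x - grad u x \<bullet> h\<bar> \<le> K * (norm h)\<^sup>2"
      "\<bar>u (x - h) - u x + grad u x \<bullet> h\<bar> \<le> K * (norm h)\<^sup>2"
      using K(2)[of x "x + h"] K(2)[of x "x - h"] by simp_all
    then show "\<bar>second_diff u x h\<bar> \<le> 2 * K * (norm h)\<^sup>2"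
      unfolding second_diff_def by linarith
  qed (use \<delta> B K in auto)
  with eventually_nhds_ball[OF \<delta>(1), of z]
  have "\<forall>\<^sub>F x in nhds z. \<forall>h. \<bar>second_diff u x h\<bar> \<le> (4 * B + 2 * K + 4 * B / \<delta>\<^sup>2) * min 1 ((norm h)\<^sup>2)"
    by (auto elim: eventually_mono)
  then show thesis
    by (rule that)
qed

lemma integrable_second_diff_kernel:
  assumes "x \<in> \<Omega>"
  shows "integrable lborel (\<lambda>h. second_diff u x h * frac_kernel s h)"
proof -
  obtain M where "\<forall>\<^sub>F y in nhds x. \<forall>h. \<bar>second_diff u y h\<bar> \<le> M * min 1 ((norm h)\<^sup>2)"
    by (rule second_diff_bound[OF assms])
  then show ?thesis
    by (intro integrable_mult_frac_kernel s_pos s_less_1) (auto dest: eventually_nhds_x_imp_x)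
qed

lemma truncated_frac_lap_eq:
  assumes "0 < \<epsilon>"
  shows "(LINT y : - ball x \<epsilon> | lborel. (u x - u y) / dist x y powr (real DIM('a) + 2 * s))
    = (LINT h : - ball 0 \<epsilon> | lborel. second_diff u x h * frac_kernel s h) / 2"
proof -
  define k where "k y = indicator (- ball x \<epsilon>) y * (u x - u y) * frac_kernel s (y - x)" for y
  have meas [measurable]: "k \<in> borel_measurable borel"
    unfolding k_def by measurable
  have "integrable lborel (\<lambda>h. k (x + h))"
  proof -
    obtain B where B: "0 \<le> B" "\<And>x. \<bar>u x\<bar> \<le> B"
      using bound_u by blast
    have "\<bar>indicator (- ball 0 \<epsilon>) h * (u x - u (x + h))\<bar>
        \<le> (2 * B + 0 + 2 * B / (\<epsilon> / 2)\<^sup>2) * min 1 ((norm h)\<^sup>2)" for h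
    proof (rule le_mult_min_one_power2)
      show "\<bar>indicator (- ball 0 \<epsilon>) h * (u x - u (x + h))\<bar> \<le> 2 * B"
        using B(2)[of x] B(2)[of "x + h"] by (auto simp: indicator_def)
    qed (use assms B in \<open>auto simp: indicator_def\<close>)
    then have "integrable lborel (\<lambda>h. indicator (- ball 0 \<epsilon>) h * (u x - u (x + h)) * frac_kernel s h)"
      by (intro integrable_mult_frac_kernel s_pos s_less_1) measurable
    then show ?thesis
      by (simp add: k_def indicator_def dist_norm)
  qed
  then have "(LINT y|lborel. k y) = (LINT h|lborel. k (x + h) + k (x - h)) / 2"
    by (intro integral_lborel_symmetrize meas)
  moreover have "k (x + h) + k (x - h)
      = indicator (- ball 0 \<epsilon>) h * (second_diff u x h * frac_kernel s h)" for h
    by (simp add: k_def second_diff_def frac_kernel_def indicator_def dist_norm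
        add_divide_distrib diff_divide_distrib)
  moreover have "k y = indicator (- ball x \<epsilon>) y * ((u x - u y) / dist x y powr (real DIM('a) + 2 * s))" for y
    by (simp add: k_def frac_kernel_def dist_norm norm_minus_commute)
  ultimately show ?thesis
    by (simp add: set_lebesgue_integral_def)
qed

lemma frac_lap_eq_integral_second_diff:
  assumes "x \<in> \<Omega>"
  shows "frac_lap s u x = frac_const DIM('a) s / 2 * (LINT h|lborel. second_diff u x h * frac_kernel s h)"
    (is "_ = _ * ?I")
proof -
  have "((\<lambda>\<epsilon>. (LINT h : - ball 0 \<epsilon> | lborel. second_diff u x h * frac_kernel s h) / 2)
      \<longlongrightarrow> ?I / 2) (at_right 0)"
    using integrable_second_diff_kernel[OF assms]
    by (intro tendsto_divide tendsto_integral_outside_ball tendsto_const) auto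
  moreover have "\<forall>\<^sub>F \<epsilon> in at_right 0. (LINT h : - ball 0 \<epsilon> | lborel. second_diff u x h * frac_kernel s h) / 2
      = (LINT y : - ball x \<epsilon> | lborel. (u x - u y) / dist x y powr (real DIM('a) + 2 * s))"
    using eventually_at_right_less[of 0] by eventually_elim (simp add: truncated_frac_lap_eq)
  ultimately have "((\<lambda>\<epsilon>. LINT y : - ball x \<epsilon> | lborel. (u x - u y) / dist x y powr (real DIM('a) + 2 * s))
      \<longlongrightarrow> ?I / 2) (at_right 0)"
    by (rule Lim_transform_eventually)
  then show ?thesis
    unfolding frac_lap_def by (subst tendsto_Lim) auto
qed

lemma continuous_on_frac_lap: "continuous_on \<Omega> (frac_lap s u)"
proof -
  have "isCont (\<lambda>x. LINT h|lborel. second_diff u x h * frac_kernel s h) z" if z: "z \<in> \<Omega>" for z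
    unfolding isCont_def
  proof -
    obtain M where M: "\<forall>\<^sub>F x in nhds z. \<forall>h. \<bar>second_diff u x h\<bar> \<le> M * min 1 ((norm h)\<^sup>2)"
      by (rule second_diff_bound[OF z])
    show "(\<lambda>x. LINT h|lborel. second_diff u x h * frac_kernel s h)
        \<midarrow>z\<rightarrow> (LINT h|lborel. second_diff u z h * frac_kernel s h)"
    proof (rule tendsto_integral_dominated)
      show "integrable lborel (\<lambda>h::'a. M * (min 1 ((norm h)\<^sup>2) * frac_kernel s h))"
        by (intro integrable_mult_right integrable_min_one_norm2_frac_kernel s_pos s_less_1)
      have "(\<lambda>x. second_diff u x h) \<midarrow>z\<rightarrow> second_diff u z h" for h
        unfolding second_diff_def
        by (intro tendsto_intros isCont_tendsto_compose[OF isCont_u])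
      then show "AE h in lborel. (\<lambda>x. second_diff u x h * frac_kernel s h)
          \<midarrow>z\<rightarrow> second_diff u z h * frac_kernel s h"
        by (intro AE_I2 tendsto_mult_right)
      have "\<forall>\<^sub>F x in at z. \<forall>h. \<bar>second_diff u x h\<bar> \<le> M * min 1 ((norm h)\<^sup>2)"
        using M unfolding eventually_at_filter by eventually_elim simp
      then show "\<forall>\<^sub>F x in at z. AE h in lborel. norm (second_diff u x h * frac_kernel s h)
          \<le> M * (min 1 ((norm h)\<^sup>2) * frac_kernel s h)"
        by eventually_elim (auto simp: abs_mult mult_right_mono simp flip: mult.assoc)
    qed measurable
  qed
  then have "continuous_on \<Omega> (\<lambda>x. frac_const DIM('a) s / 2 *
      (LINT h|lborel. second_diff u x h * frac_kernel s h))"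
    by (intro continuous_intros continuous_at_imp_continuous_on) auto
  then show ?thesis
    by (simp add: frac_lap_eq_integral_second_diff cong: continuous_on_cong)
qed

definition kernel_mass :: real where
  "kernel_mass = frac_const DIM('a) s / 2 * (LINT h::'a|lborel. min 1 ((norm h)\<^sup>2) * frac_kernel s h)"

lemma kernel_mass_nonneg: "0 \<le> kernel_mass"
  unfolding kernel_mass_def using frac_const_pos[OF s_pos s_less_1]
  by (intro mult_nonneg_nonneg integral_nonneg_AE AE_I2) (auto intro: less_imp_le)

lemma frac_lap_le:
  assumes "x \<in> \<Omega>" and bound: "\<And>h. second_diff u x h \<le> M * min 1 ((norm h)\<^sup>2)"
  shows "frac_lap s u x \<le> M * kernel_mass"
proof -
  have "(LINT h|lborel. second_diff u x h * frac_kernel s h)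
      \<le> (LINT h|lborel. M * (min 1 ((norm (h::'a))\<^sup>2) * frac_kernel s h))"
  proof (rule integral_mono)
    fix h :: 'a
    show "second_diff u x h * frac_kernel s h \<le> M * (min 1 ((norm h)\<^sup>2) * frac_kernel s h)"
      using mult_right_mono[OF bound, of "frac_kernel s h" h] by (simp add: mult.assoc)
  qed (intro integrable_second_diff_kernel integrable_mult_right integrable_min_one_norm2_frac_kernel
      s_pos s_less_1 \<open>x \<in> \<Omega>\<close>)+
  then have "frac_lap s u x
      \<le> frac_const DIM('a) s / 2 * (LINT h|lborel. M * (min 1 ((norm (h::'a))\<^sup>2) * frac_kernel s h))"
    unfolding frac_lap_eq_integral_second_diff[OF \<open>x \<in> \<Omega>\<close>]
    using frac_const_pos[OF s_pos s_less_1, of "DIM('a)"] by (intro mult_left_mono) auto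
  then show ?thesis
    by (simp add: kernel_mass_def ac_simps)
qed

lemma frac_lap_neg_at_global_min:
  assumes "x \<in> \<Omega>" and min: "\<And>y. u x \<le> u y" and less: "u x < u y"
  shows "frac_lap s u x < 0"
proof -
  let ?K = "\<lambda>h. - second_diff u x h * frac_kernel s h"
  have K_int: "integrable lborel ?K"
    using integrable_second_diff_kernel[OF \<open>x \<in> \<Omega>\<close>] by simp
  have second_diff_nonpos: "second_diff u x h \<le> 0" for h
    using min[of "x + h"] min[of "x - h"] by (simp add: second_diff_def)
  then have K_nonneg: "0 \<le> ?K h" for h
    by (intro mult_nonneg_nonneg) auto
  have "(LINT h|lborel. ?K h) \<noteq> 0"
  proof
    assume "(LINT h|lborel. ?K h) = 0"
    then have "AE h in lborel. ?K h = 0"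
      using integral_nonneg_eq_0_iff_AE[OF K_int] K_nonneg by simp
    then have "AE h in lborel. 0 \<le> second_diff u x h"
      using AE_lborel_singleton[of 0] by eventually_elim (simp add: frac_kernel_def)
    then have "AE h in lebesgue_on UNIV. 0 \<le> second_diff u x h"
      by (subst AE_restrict_space_iff) (auto intro: AE_completion)
    moreover have "continuous_on UNIV (second_diff u x)"
      unfolding second_diff_def by (intro continuous_intros continuous_on_compose2[OF cont]) auto
    ultimately have "0 \<le> second_diff u x (y - x)"
      by (intro AE_nonneg_imp_nonneg_on_open[of UNIV]) auto
    then show False
      using less min[of "x - (y - x)"] by (simp add: second_diff_def)
  qed
  moreover have "0 \<le> (LINT h|lborel. ?K h)"
    by (intro integral_nonneg_AE AE_I2 K_nonneg)
  ultimately have "(LINT h|lborel. second_diff u x h * frac_kernel s h) < 0"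
    by simp
  then show ?thesis
    unfolding frac_lap_eq_integral_second_diff[OF \<open>x \<in> \<Omega>\<close>]
    using frac_const_pos[OF s_pos s_less_1] by (intro mult_pos_neg) auto
qed

subsection \<open>Minimum principle and growth at the boundary\<close>

lemma continuous_on_extremal_operator: "continuous_on \<Omega> (extremal_operator s C u)"
  unfolding extremal_operator_def laplacian_def using C2
  by (intro continuous_intros continuous_on_frac_lap C2_on_continuous_on_grad) (auto simp: C2_on_def)

lemma extremal_operator_nonneg:
  assumes q_bound: "\<exists>C. AE x in lebesgue_on \<Omega>. norm (q x) \<le> C"
    and supersolution: "AE x in lebesgue_on \<Omega>.
      - laplacian u x + frac_lap s u x + frechet_derivative u (at x) (q x) \<ge> 0"
  obtains C where "0 \<le> C" "\<And>x. x \<in> \<Omega> \<Longrightarrow> 0 \<le> extremal_operator s C u x"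
proof -
  obtain C where C: "AE x in lebesgue_on \<Omega>. norm (q x) \<le> C"
    using q_bound by blast
  have "AE x in lebesgue_on \<Omega>. x \<in> \<Omega>"
    by (rule AE_I2) (simp add: space_restrict_space)
  then have "AE x in lebesgue_on \<Omega>. 0 \<le> extremal_operator s (max 0 C) u x"
    using C supersolution
  proof eventually_elim
    case (elim x)
    have "frechet_derivative u (at x) (q x) = grad u x \<bullet> q x"
      using differentiable_u[OF elim(1)] by (rule frechet_derivative_eq_inner_grad)
    also have "\<dots> \<le> norm (q x) * norm (grad u x)"
      by (metis norm_cauchy_schwarz mult.commute)
    also have "\<dots> \<le> max 0 C * norm (grad u x)"
      using elim(2) by (intro mult_right_mono) auto
    finally show ?case
      using elim(3) by (simp add: extremal_operator_def)
  qed
  then have "0 \<le> extremal_operator s (max 0 C) u x" if "x \<in> \<Omega>" for x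
    using that by (rule AE_nonneg_imp_nonneg_on_open[OF open_\<Omega> continuous_on_extremal_operator])
  then show thesis
    by (intro that[of "max 0 C"]) simp_all
qed

lemma strong_minimum_principle:
  assumes supersolution: "\<And>x. x \<in> \<Omega> \<Longrightarrow> 0 \<le> extremal_operator s C u x"
    and ge: "\<And>x. c \<le> u x" and "u y \<noteq> c" and "x \<in> \<Omega>"
  shows "c < u x"
proof (rule ccontr)
  assume "\<not> c < u x"
  then have "u x = c"
    using ge[of x] by linarith
  then have "frac_lap s u x < 0"
    using \<open>x \<in> \<Omega>\<close> ge \<open>u y \<noteq> c\<close> by (intro frac_lap_neg_at_global_min[of _ y]) (auto simp: order_less_le)
  moreover have const: "C2_on \<Omega> (\<lambda>_. c)" "grad (\<lambda>_. c) x = 0" "laplacian (\<lambda>_. c) x = 0"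
    by (simp_all add: C2_on_def d1_def[abs_def] d2_def[abs_def] grad_def laplacian_def)
  then have "grad u x = 0" "0 \<le> laplacian u x"
    using C2_on_touching_below[OF open_\<Omega> \<open>x \<in> \<Omega>\<close> C2 const(1)] ge \<open>u x = c\<close> by auto
  ultimately show False
    using supersolution[OF \<open>x \<in> \<Omega>\<close>] by (simp add: extremal_operator_def)
qed

lemma extremal_operator_le_at_gaussian_touching:
  fixes y :: 'a
  assumes "x \<in> \<Omega>" and A: "0 \<le> A" and \<alpha>: "1 \<le> \<alpha>"
    and touch: "\<And>z. u x - gaussian A \<alpha> y x \<le> u z - gaussian A \<alpha> y z"
    and near_inf: "\<And>z. u x - gaussian A \<alpha> y x \<le> u z"
  shows "extremal_operator s C u x \<le> \<alpha> * gaussian A \<alpha> y x *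
    (2 * DIM('a) + 2 * kernel_mass + 2 * C * norm (x - y) - 4 * \<alpha> * (norm (x - y))\<^sup>2)"
proof -
  define E where "E = gaussian A \<alpha> y x"
  have E: "0 \<le> E"
    using A by (simp add: E_def gaussian_def)
  have "second_diff u x h \<le> 2 * \<alpha> * E * min 1 ((norm h)\<^sup>2)" for h
  proof -
    have "second_diff u x h \<le> 2 * E"
      using near_inf[of "x + h"] near_inf[of "x - h"] by (simp add: second_diff_def E_def)
    also have "\<dots> \<le> 2 * \<alpha> * E"
      using E \<alpha> by (simp add: mult_le_cancel_right1)
    finally have "second_diff u x h \<le> 2 * \<alpha> * E" .
    moreover have "second_diff u x h \<le> second_diff (gaussian A \<alpha> y) x h"
      using touch[of "x + h"] touch[of "x - h"] by (simp add: second_diff_def)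
    then have "second_diff u x h \<le> 2 * \<alpha> * E * (norm h)\<^sup>2"
      unfolding E_def using second_diff_gaussian_le[of A \<alpha> y x h] A \<alpha> by linarith
    ultimately show ?thesis
      by (simp add: min_def)
  qed
  then have nonlocal: "frac_lap s u x \<le> 2 * \<alpha> * E * kernel_mass"
    by (rule frac_lap_le[OF \<open>x \<in> \<Omega>\<close>])
  have derivs: "grad u x = grad (gaussian A \<alpha> y) x" "laplacian (gaussian A \<alpha> y) x \<le> laplacian u x"
    using C2_on_touching_below[OF open_\<Omega> \<open>x \<in> \<Omega>\<close> C2 C2_on_gaussian] touch by blast+
  have "norm (grad u x) = 2 * \<alpha> * E * norm (x - y)"
    using E \<alpha> by (simp add: derivs(1) grad_gaussian abs_mult flip: E_def)
  then show ?thesis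
    using nonlocal derivs(2) unfolding extremal_operator_def laplacian_gaussian E_def[symmetric]
    by (simp add: algebra_simps power2_eq_square)
qed

lemma gaussian_barrier_le_supersolution:
  fixes y :: 'a
  assumes supersolution: "\<And>x. x \<in> \<Omega> \<Longrightarrow> 0 \<le> extremal_operator s C u x" and "0 \<le> C"
    and ge: "\<And>x. c \<le> u x" and r: "0 < r" "ball y r \<subseteq> \<Omega>"
    and A: "0 < A" "\<And>x. x \<in> cball y (r / 2) \<Longrightarrow> c + A \<le> u x"
    and \<alpha>: "1 \<le> \<alpha>" "2 * DIM('a) + 2 * kernel_mass + 2 * C * r < \<alpha> * r\<^sup>2"
    and x: "x \<in> ball y r"
  shows "c + gaussian_barrier A \<alpha> y r x \<le> u x"
proof (rule ccontr)
  assume "\<not> c + gaussian_barrier A \<alpha> y r x \<le> u x"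
  moreover have "continuous_on (cball y r) u"
    using cont continuous_on_subset by blast
  ultimately obtain w where w: "w \<in> ball y r" "u w < c + gaussian_barrier A \<alpha> y r w"
    and touch: "\<And>z. u w - gaussian A \<alpha> y w \<le> u z - gaussian A \<alpha> y z"
    using gaussian_barrier_touching_point[of y r u c A \<alpha> x] ge x A(1) \<alpha>(1) by auto
  define \<rho> where "\<rho> = norm (w - y)"
  have "w \<notin> cball y (r / 2)"
    using A w(2) gaussian_barrier_le[of A \<alpha> y r w] \<alpha>(1) by fastforce
  then have \<rho>: "r / 2 \<le> \<rho>" "\<rho> < r"
    using w(1) by (auto simp: \<rho>_def dist_norm norm_minus_commute)
  have "u w - gaussian A \<alpha> y w \<le> u z" for z
  proof -
    have "gaussian_barrier A \<alpha> y r w \<le> gaussian A \<alpha> y w"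
      using A(1) by (simp add: gaussian_barrier_def)
    then show ?thesis
      using w(2) ge[of z] by linarith
  qed
  then have "extremal_operator s C u w \<le> \<alpha> * gaussian A \<alpha> y w *
      (2 * DIM('a) + 2 * kernel_mass + 2 * C * \<rho> - 4 * \<alpha> * \<rho>\<^sup>2)"
    unfolding \<rho>_def using w(1) r(2) A(1) \<alpha>(1) touch by (intro extremal_operator_le_at_gaussian_touching) auto
  moreover have "2 * DIM('a) + 2 * kernel_mass + 2 * C * \<rho> - 4 * \<alpha> * \<rho>\<^sup>2 < 0"
    using \<rho> \<alpha> r(1) \<open>0 \<le> C\<close> by (intro touching_coefficient_neg[of r]) auto
  then have "\<alpha> * gaussian A \<alpha> y w * (2 * DIM('a) + 2 * kernel_mass + 2 * C * \<rho> - 4 * \<alpha> * \<rho>\<^sup>2) < 0"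
    using \<alpha>(1) gaussian_pos[OF A(1)] by (intro mult_pos_neg mult_pos_pos) auto
  ultimately show False
    using supersolution[of w] w(1) r(2) by fastforce
qed

lemma gaussian_barrier_exists:
  fixes y :: 'a
  assumes supersolution: "\<And>x. x \<in> \<Omega> \<Longrightarrow> 0 \<le> extremal_operator s C u x" and "0 \<le> C"
    and ge: "\<And>x. c \<le> u x" and greater: "\<And>x. x \<in> \<Omega> \<Longrightarrow> c < u x"
    and r: "0 < r" "ball y r \<subseteq> \<Omega>"
  obtains A \<alpha> where "0 < A" "0 < \<alpha>" "\<And>x. x \<in> ball y r \<Longrightarrow> c + gaussian_barrier A \<alpha> y r x \<le> u x"
proof -
  have "continuous_on (cball y (r / 2)) u"
    using cont continuous_on_subset by blast
  then obtain w where w: "w \<in> cball y (r / 2)" "\<And>x. x \<in> cball y (r / 2) \<Longrightarrow> u w \<le> u x"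
    using continuous_attains_inf[of "cball y (r / 2)" u] r(1) by auto
  define A where "A = u w - c"
  have "w \<in> \<Omega>"
    using w(1) r by (auto simp: subset_iff)
  then have A: "0 < A" "\<And>x. x \<in> cball y (r / 2) \<Longrightarrow> c + A \<le> u x"
    using greater w(2) by (auto simp: A_def)
  define Q where "Q = 2 * DIM('a) + 2 * kernel_mass + 2 * C * r"
  define \<alpha> where "\<alpha> = 1 + Q / r\<^sup>2"
  have "0 \<le> Q"
    using kernel_mass_nonneg \<open>0 \<le> C\<close> r(1) by (simp add: Q_def)
  then have \<alpha>: "1 \<le> \<alpha>" "Q < \<alpha> * r\<^sup>2"
    using r(1) by (auto simp: \<alpha>_def distrib_right)
  then have "c + gaussian_barrier A \<alpha> y r x \<le> u x" if "x \<in> ball y r" for x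
    using gaussian_barrier_le_supersolution[OF supersolution \<open>0 \<le> C\<close> ge r A] that by (simp add: Q_def)
  moreover have "0 < \<alpha>"
    using \<alpha>(1) by linarith
  ultimately show thesis
    using that A(1) by blast
qed

lemma linear_growth_from_boundary:
  assumes supersolution: "\<And>x. x \<in> \<Omega> \<Longrightarrow> 0 \<le> extremal_operator s C u x" and "0 \<le> C"
    and ge: "\<And>x. c \<le> u x" and greater: "\<And>x. x \<in> \<Omega> \<Longrightarrow> c < u x"
    and "norm \<nu> = 1" and r: "0 < r" "ball (x0 - r *\<^sub>R \<nu>) r \<subseteq> \<Omega>"
  obtains \<kappa> where "0 < \<kappa>" "\<And>t. 0 < t \<Longrightarrow> t < r \<Longrightarrow> c + \<kappa> * t \<le> u (x0 - t *\<^sub>R \<nu>)"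
proof -
  obtain A \<alpha> where barrier: "0 < A" "0 < \<alpha>"
    "\<And>x. x \<in> ball (x0 - r *\<^sub>R \<nu>) r \<Longrightarrow> c + gaussian_barrier A \<alpha> (x0 - r *\<^sub>R \<nu>) r x \<le> u x"
    using gaussian_barrier_exists[OF supersolution \<open>0 \<le> C\<close> ge greater r] by blast
  have "c + A * exp (- \<alpha> * r\<^sup>2) * \<alpha> * r * t \<le> u (x0 - t *\<^sub>R \<nu>)" if t: "0 < t" "t < r" for t
  proof -
    have "A * exp (- \<alpha> * r\<^sup>2) * \<alpha> * r * t \<le> gaussian_barrier A \<alpha> (x0 - r *\<^sub>R \<nu>) r (x0 - t *\<^sub>R \<nu>)"
      using barrier(1,2) t \<open>norm \<nu> = 1\<close>
      by (intro gaussian_barrier_ge_linear) (simp_all flip: scaleR_diff_left)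
    then show ?thesis
      using barrier(3)[OF inward_normal_in_ball[OF \<open>norm \<nu> = 1\<close> t]] by linarith
  qed
  moreover have "0 < A * exp (- \<alpha> * r\<^sup>2) * \<alpha> * r"
    using barrier(1,2) r(1) by simp
  ultimately show thesis
    using that by blast
qed

end

subsection \<open>Interior balls at the boundary\<close>

lemma inner_hproj: "hproj e v \<bullet> w = v \<bullet> hproj e w"
  by (simp add: hproj_def inner_simps inner_commute)

lemma hproj_diff: "hproj e x - hproj e y = hproj e (x - y)"
  by (simp add: hproj_def inner_simps algebra_simps)

lemma hproj_self:
  assumes "norm e = 1"
  shows "hproj e e = 0"
  using assms by (simp add: hproj_def norm_eq_1)

lemma norm_hproj_le:
  assumes "norm e = 1"
  shows "norm (hproj e v) \<le> norm v"
proof (rule power2_le_imp_le)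
  have "(norm (hproj e v))\<^sup>2 = (norm v)\<^sup>2 - (v \<bullet> e)\<^sup>2"
    using assms unfolding hproj_def power2_norm_eq_inner norm_eq_1
    by (simp add: inner_simps inner_commute power2_eq_square algebra_simps)
  then show "(norm (hproj e v))\<^sup>2 \<le> (norm v)\<^sup>2"
    by simp
qed simp

definition defining_function :: "'a::euclidean_space \<Rightarrow> ('a \<Rightarrow> real) \<Rightarrow> 'a \<Rightarrow> real" where
  "defining_function e \<phi> x = x \<bullet> e - \<phi> (hproj e x)"

lemma has_derivative_defining_function:
  assumes "\<phi> differentiable (at (hproj e x))"
  shows "(defining_function e \<phi> has_derivative (\<lambda>v. (e - hproj e (grad \<phi> (hproj e x))) \<bullet> v)) (at x)"
proof -
  have "(hproj e has_derivative hproj e) (at x)"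
    unfolding hproj_def[abs_def] by (auto intro!: derivative_eq_intros)
  from has_derivative_compose[OF this has_derivative_grad[OF assms]]
  have "((\<lambda>x. x \<bullet> e - \<phi> (hproj e x)) has_derivative (\<lambda>v. v \<bullet> e - grad \<phi> (hproj e x) \<bullet> hproj e v)) (at x)"
    by (intro has_derivative_diff has_derivative_inner_left has_derivative_ident)
  then show ?thesis
    by (simp add: defining_function_def[abs_def] inner_diff_left inner_hproj inner_commute[of e])
qed

lemma grad_defining_function:
  assumes "\<phi> differentiable (at (hproj e x))"
  shows "grad (defining_function e \<phi>) x = e - hproj e (grad \<phi> (hproj e x))"
  using has_derivative_defining_function[OF assms] by (rule grad_eqI)

lemma grad_defining_function_nonzero:
  assumes "\<phi> differentiable (at (hproj e x))" and "norm e = 1"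
  shows "grad (defining_function e \<phi>) x \<noteq> 0"
proof -
  have "grad (defining_function e \<phi>) x \<bullet> e = 1"
    using assms(2) by (simp add: grad_defining_function[OF assms(1)]
        inner_diff_left inner_hproj hproj_self norm_eq_1)
  then show ?thesis
    by auto
qed

lemma defining_function_nonpos_on_closure:
  assumes chart: "C2_chart \<Omega> x0 r e \<phi>" and "x0 \<in> closure \<Omega>"
  shows "defining_function e \<phi> x0 \<le> 0"
proof -
  have "continuous_on UNIV (defining_function e \<phi>)"
    using chart has_derivative_defining_function unfolding C2_chart_def C2_on_def
    by (intro continuous_at_imp_continuous_on) (blast intro: has_derivative_continuous)
  then have "closed {x. defining_function e \<phi> x \<le> 0}"
    by (intro closed_Collect_le continuous_on_const)
  moreover have "ball x0 r \<inter> \<Omega> \<subseteq> {x. defining_function e \<phi> x \<le> 0}"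
    using chart unfolding C2_chart_def defining_function_def by force
  ultimately have "closure (ball x0 r \<inter> \<Omega>) \<subseteq> {x. defining_function e \<phi> x \<le> 0}"
    by (intro closure_minimal)
  moreover have "x0 \<in> closure (ball x0 r \<inter> \<Omega>)"
    using open_Int_closure_subset[OF open_ball, of x0 r \<Omega>] assms by (auto simp: C2_chart_def)
  ultimately show ?thesis
    by blast
qed

lemma defining_function_Taylor_bound:
  assumes \<phi>: "C2_on UNIV \<phi>" and e: "norm e = 1"
  obtains M where "0 \<le> M" "\<And>x. x \<in> ball x0 1 \<Longrightarrow>
    defining_function e \<phi> x \<le> defining_function e \<phi> x0 + grad (defining_function e \<phi>) x0 \<bullet> (x - x0)
      + M * (norm (x - x0))\<^sup>2"
proof -
  let ?p = "hproj e"
  obtain M where M: "0 \<le> M" "\<And>p q. p \<in> cball (?p x0) 1 \<Longrightarrow> q \<in> cball (?p x0) 1 \<Longrightarrow>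
      \<bar>\<phi> q - \<phi> p - grad \<phi> p \<bullet> (q - p)\<bar> \<le> M * (norm (q - p))\<^sup>2"
    using C2_on_Taylor_bound[OF \<phi>, of "cball (?p x0) 1"] by auto
  have "defining_function e \<phi> x \<le> defining_function e \<phi> x0 + grad (defining_function e \<phi>) x0 \<bullet> (x - x0)
      + M * (norm (x - x0))\<^sup>2" if "x \<in> ball x0 1" for x
  proof -
    have proj_le: "norm (?p (x - x0)) \<le> norm (x - x0)"
      by (rule norm_hproj_le[OF e])
    then have "dist (?p x) (?p x0) \<le> dist x x0"
      by (simp add: dist_norm hproj_diff)
    then have "?p x \<in> cball (?p x0) 1"
      using that by (simp add: dist_commute)
    then have "\<bar>\<phi> (?p x) - \<phi> (?p x0) - grad \<phi> (?p x0) \<bullet> ?p (x - x0)\<bar> \<le> M * (norm (?p (x - x0)))\<^sup>2"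
      using M(2)[of "?p x0" "?p x"] by (simp add: hproj_diff)
    also have "\<dots> \<le> M * (norm (x - x0))\<^sup>2"
      using proj_le M(1) by (intro mult_left_mono power_mono) auto
    finally have "- \<phi> (?p x) \<le> - \<phi> (?p x0) - grad \<phi> (?p x0) \<bullet> ?p (x - x0) + M * (norm (x - x0))\<^sup>2"
      by linarith
    moreover have "grad (defining_function e \<phi>) x0 \<bullet> (x - x0)
        = x \<bullet> e - x0 \<bullet> e - grad \<phi> (?p x0) \<bullet> ?p (x - x0)"
      using \<phi> by (subst grad_defining_function)
        (auto simp: C2_on_def inner_diff_left inner_diff_right inner_hproj inner_commute[of e]
          simp flip: hproj_diff)
    ultimately show ?thesis
      by (simp add: defining_function_def)
  qed
  then show thesis
    using that M(1) by blast
qed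

lemma norm_less_in_tangent_ball:
  fixes \<nu> :: "'a::real_inner"
  assumes "norm \<nu> = 1" and x: "x \<in> ball (x0 - r *\<^sub>R \<nu>) r"
  shows "norm (x - x0) < 2 * r" "(norm (x - x0))\<^sup>2 < - 2 * r * (\<nu> \<bullet> (x - x0))"
proof -
  define v where "v = x - x0"
  have near: "norm (v + r *\<^sub>R \<nu>) < r"
    using x by (simp add: v_def dist_norm norm_minus_commute algebra_simps)
  then have "0 < r"
    using norm_ge_zero by (rule le_less_trans[rotated])
  have "norm v \<le> norm (v + r *\<^sub>R \<nu>) + norm (r *\<^sub>R \<nu>)"
    using norm_triangle_ineq4[of "v + r *\<^sub>R \<nu>" "r *\<^sub>R \<nu>"] by simp
  then show "norm (x - x0) < 2 * r"
    using near \<open>0 < r\<close> assms(1) by (simp add: v_def)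
  have "(norm (v + r *\<^sub>R \<nu>))\<^sup>2 < r\<^sup>2"
    using near by (intro power_strict_mono) auto
  then show "(norm (x - x0))\<^sup>2 < - 2 * r * (\<nu> \<bullet> (x - x0))"
    using assms(1) unfolding v_def[symmetric] power2_norm_eq_inner norm_eq_1
    by (simp add: inner_simps inner_commute power2_eq_square)
qed

lemma interior_ball_of_sublevel_set:
  fixes g :: "'a::euclidean_space"
  assumes "g \<noteq> 0" "0 < \<delta>" "0 \<le> M"
    and bound: "\<And>x. x \<in> ball x0 \<delta> \<Longrightarrow> \<psi> x \<le> g \<bullet> (x - x0) + M * (norm (x - x0))\<^sup>2"
  obtains r where "0 < r" "ball (x0 - r *\<^sub>R sgn g) r \<subseteq> {x \<in> ball x0 \<delta>. \<psi> x < 0}"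
proof -
  define r where "r = min (\<delta> / 2) (norm g / (2 * (M + 1)))"
  have r: "0 < r" "2 * r \<le> \<delta>" "r \<le> norm g / (2 * (M + 1))"
    using assms(1-3) by (auto simp: r_def)
  have M_le: "M + 1 \<le> norm g / (2 * r)"
    using r \<open>0 \<le> M\<close> by (simp add: field_simps)
  have "x \<in> ball x0 \<delta> \<and> \<psi> x < 0" if "x \<in> ball (x0 - r *\<^sub>R sgn g) r" for x
  proof -
    define v where "v = x - x0"
    have v: "norm v < 2 * r" "(norm v)\<^sup>2 < - 2 * r * (sgn g \<bullet> v)"
      unfolding v_def using norm_less_in_tangent_ball[OF _ that] \<open>g \<noteq> 0\<close> by (simp_all add: norm_sgn)
    then have "norm g / (2 * r) * (norm v)\<^sup>2 < norm g / (2 * r) * (- 2 * r * (sgn g \<bullet> v))"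
      using \<open>g \<noteq> 0\<close> r by (intro mult_strict_left_mono) auto
    also have "\<dots> = - (g \<bullet> v)"
      using \<open>g \<noteq> 0\<close> r by (simp add: sgn_div_norm)
    finally have "norm g / (2 * r) * (norm v)\<^sup>2 < - (g \<bullet> v)" .
    moreover have "M * (norm v)\<^sup>2 \<le> norm g / (2 * r) * (norm v)\<^sup>2"
      using M_le by (intro mult_right_mono) auto
    moreover have "x \<in> ball x0 \<delta>"
      using v(1) r(2) by (simp add: v_def dist_norm norm_minus_commute)
    ultimately show ?thesis
      using bound[of x] unfolding v_def by linarith
  qed
  then show thesis
    using that[OF r(1)] by blast
qed

lemma interior_ball_at_boundary:
  fixes \<Omega> :: "'a::euclidean_space set"
  assumes "x0 \<in> frontier \<Omega>" and "outer_unit_normal \<Omega> x0 \<nu>"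
  obtains r where "norm \<nu> = 1" "0 < r" "ball (x0 - r *\<^sub>R \<nu>) r \<subseteq> \<Omega>"
proof -
  obtain R e \<phi> where chart: "C2_chart \<Omega> x0 R e \<phi>"
    and \<nu>: "\<nu> = sgn (grad (defining_function e \<phi>) x0)"
    using assms(2) by (auto simp: outer_unit_normal_def Let_def sgn_div_norm divide_inverse
        defining_function_def[abs_def])
  define g where "g = grad (defining_function e \<phi>) x0"
  have R: "0 < R" and e: "norm e = 1" and \<phi>: "C2_on UNIV \<phi>"
    and \<Omega>_eq: "\<Omega> \<inter> ball x0 R = {x \<in> ball x0 R. defining_function e \<phi> x < 0}"
    using chart by (auto simp: C2_chart_def defining_function_def)
  have "g \<noteq> 0"
    using \<phi> e unfolding g_def by (intro grad_defining_function_nonzero) (auto simp: C2_on_def)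
  obtain M where M: "0 \<le> M" "\<And>x. x \<in> ball x0 1 \<Longrightarrow> defining_function e \<phi> x
      \<le> defining_function e \<phi> x0 + g \<bullet> (x - x0) + M * (norm (x - x0))\<^sup>2"
    using defining_function_Taylor_bound[OF \<phi> e] unfolding g_def by blast
  have "defining_function e \<phi> x0 \<le> 0"
    using chart assms(1) by (intro defining_function_nonpos_on_closure) (auto simp: frontier_def)
  then have "defining_function e \<phi> x \<le> g \<bullet> (x - x0) + M * (norm (x - x0))\<^sup>2" if "x \<in> ball x0 (min R 1)" for x
    using M(2)[of x] that by simp
  then obtain r where "0 < r"
    "ball (x0 - r *\<^sub>R sgn g) r \<subseteq> {x \<in> ball x0 (min R 1). defining_function e \<phi> x < 0}"
    using interior_ball_of_sublevel_set[OF \<open>g \<noteq> 0\<close> _ M(1), of "min R 1" x0 "defining_function e \<phi>"] R by auto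
  moreover have "norm \<nu> = 1" "\<nu> = sgn g"
    using \<open>g \<noteq> 0\<close> by (simp_all add: \<nu> g_def norm_sgn)
  ultimately show thesis
    using that[of r] \<Omega>_eq by auto
qed

subsection \<open>The normal derivative\<close>

lemma tendsto_normal_deriv:
  fixes u :: "'a::euclidean_space \<Rightarrow> real"
  assumes u: "C2_closure \<Omega> u" and "open \<Omega>" "x0 \<in> frontier \<Omega>"
  shows "((\<lambda>x. frechet_derivative u (at x) \<nu>) \<longlongrightarrow> normal_deriv \<Omega> u x0 \<nu>) (at x0 within \<Omega>)"
proof -
  have x0: "x0 \<in> closure \<Omega>" "x0 \<notin> \<Omega>"
    using assms(2,3) by (auto simp: frontier_def interior_open)
  then have nontrivial: "at x0 within \<Omega> \<noteq> bot"
    by (simp add: trivial_limit_within islimpt_in_closure)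
  obtain g where g: "\<And>b. b \<in> Basis \<Longrightarrow> continuous_on (closure \<Omega>) (g b)"
    "\<And>b x. b \<in> Basis \<Longrightarrow> x \<in> \<Omega> \<Longrightarrow> g b x = d1 u b x"
    using u unfolding C2_closure_def by metis
  have "(g b \<longlongrightarrow> g b x0) (at x0 within \<Omega>)" if "b \<in> Basis" for b
    using g(1)[OF that] x0(1) closure_subset by (meson continuous_on_def tendsto_within_subset)
  then have "((\<lambda>x. \<Sum>b\<in>Basis. (\<nu> \<bullet> b) * g b x) \<longlongrightarrow> (\<Sum>b\<in>Basis. (\<nu> \<bullet> b) * g b x0)) (at x0 within \<Omega>)"
    by (intro tendsto_intros)
  moreover have "\<forall>\<^sub>F x in at x0 within \<Omega>. (\<Sum>b\<in>Basis. (\<nu> \<bullet> b) * g b x) = frechet_derivative u (at x) \<nu>"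
    using u unfolding eventually_at_filter
    by (auto simp: C2_closure_def C2_on_def frechet_derivative_eq_inner_grad inner_grad_eq_sum_d1 g(2))
  ultimately have lim: "((\<lambda>x. frechet_derivative u (at x) \<nu>) \<longlongrightarrow> (\<Sum>b\<in>Basis. (\<nu> \<bullet> b) * g b x0)) (at x0 within \<Omega>)"
    by (rule Lim_transform_eventually)
  then have "normal_deriv \<Omega> u x0 \<nu> = (\<Sum>b\<in>Basis. (\<nu> \<bullet> b) * g b x0)"
    unfolding normal_deriv_def by (rule tendsto_Lim[OF nontrivial])
  with lim show ?thesis
    by simp
qed

lemma deriv_limit_ge_of_linear_growth:
  fixes f f' :: "real \<Rightarrow> real"
  assumes "0 < r" and cont: "continuous_on {0..<r} f"
    and deriv: "\<And>t. 0 < t \<Longrightarrow> t < r \<Longrightarrow> (f has_real_derivative f' t) (at t)"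
    and lim: "(f' \<longlongrightarrow> l) (at_right 0)"
    and growth: "\<And>t. 0 < t \<Longrightarrow> t < r \<Longrightarrow> f 0 + \<kappa> * t \<le> f t"
  shows "\<kappa> \<le> l"
proof (rule ccontr)
  assume "\<not> \<kappa> \<le> l"
  then have "\<forall>\<^sub>F t in at_right 0. f' t < \<kappa>"
    by (intro order_tendstoD(2)[OF lim]) simp
  then obtain d where d: "0 < d" "\<And>t. 0 < t \<Longrightarrow> t < d \<Longrightarrow> f' t < \<kappa>"
    unfolding eventually_at_right_field by blast
  define t where "t = min d r / 2"
  have t: "0 < t" "t < d" "t < r"
    using d \<open>0 < r\<close> by (auto simp: t_def min_def)
  have cont_t: "continuous_on {0..t} f"
    using cont by (rule continuous_on_subset) (use t in auto)
  have deriv_t: "(f has_derivative (\<lambda>h. f' \<tau> * h)) (at \<tau>)" if "0 < \<tau>" "\<tau> < t" for \<tau>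
    using deriv[of \<tau>] that t by (simp add: has_field_derivative_def)
  from mvt[OF t(1) cont_t deriv_t] obtain \<tau> where \<tau>: "0 < \<tau>" "\<tau> < t" "f t - f 0 = f' \<tau> * (t - 0)"
    by blast
  have "f' \<tau> < \<kappa>"
    using d(2) \<tau> t by simp
  then have "f t < f 0 + \<kappa> * t"
    using \<tau>(3) t(1) by (simp add: algebra_simps)
  then show False
    using growth[OF t(1,3)] by linarith
qed

lemma normal_deriv_le_of_linear_growth:
  fixes u :: "'a::euclidean_space \<Rightarrow> real"
  assumes u: "C2_closure \<Omega> u" and "open \<Omega>" and x0: "x0 \<in> frontier \<Omega>" and "\<nu> \<noteq> 0" "0 < r"
    and inside: "\<And>t. 0 < t \<Longrightarrow> t < r \<Longrightarrow> x0 - t *\<^sub>R \<nu> \<in> \<Omega>"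
    and growth: "\<And>t. 0 < t \<Longrightarrow> t < r \<Longrightarrow> u x0 + \<kappa> * t \<le> u (x0 - t *\<^sub>R \<nu>)"
  shows "normal_deriv \<Omega> u x0 \<nu> \<le> - \<kappa>"
proof -
  have "\<kappa> \<le> - normal_deriv \<Omega> u x0 \<nu>"
  proof (rule deriv_limit_ge_of_linear_growth[OF \<open>0 < r\<close>])
    have in_closure: "x0 - t *\<^sub>R \<nu> \<in> closure \<Omega>" if t: "t \<in> {0..<r}" for t
    proof (cases "t = 0")
      case True
      then show ?thesis
        using x0 by (simp add: frontier_def)
    next
      case False
      then have "x0 - t *\<^sub>R \<nu> \<in> \<Omega>"
        using t by (intro inside) auto
      then show ?thesis
        using closure_subset by blast
    qed
    have "continuous_on (closure \<Omega>) u"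
      using u by (simp add: C2_closure_def)
    then show "continuous_on {0..<r} (\<lambda>t. u (x0 - t *\<^sub>R \<nu>))"
      by (rule continuous_on_compose2) (use in_closure in \<open>auto intro!: continuous_intros\<close>)
    show "((\<lambda>t. u (x0 - t *\<^sub>R \<nu>)) has_real_derivative - frechet_derivative u (at (x0 - t *\<^sub>R \<nu>)) \<nu>) (at t)"
      if "0 < t" "t < r" for t
    proof -
      have "u differentiable (at (x0 - t *\<^sub>R \<nu>))"
        using u inside[OF that] by (simp add: C2_closure_def C2_on_def)
      then show ?thesis
        using has_real_derivative_along_line[of u x0 t "- \<nu>"] by (simp add: frechet_derivative_eq_inner_grad)
    qed
    have "\<forall>\<^sub>F t in at_right 0. x0 - t *\<^sub>R \<nu> \<in> \<Omega> \<and> x0 - t *\<^sub>R \<nu> \<noteq> x0"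
      using eventually_at_right_real[OF \<open>0 < r\<close>] by eventually_elim (use inside \<open>\<nu> \<noteq> 0\<close> in auto)
    moreover have "((\<lambda>t. x0 - t *\<^sub>R \<nu>) \<longlongrightarrow> x0) (at_right 0)"
      by (auto intro!: tendsto_eq_intros)
    ultimately have "filterlim (\<lambda>t. x0 - t *\<^sub>R \<nu>) (at x0 within \<Omega>) (at_right 0)"
      by (simp add: filterlim_at)
    from filterlim_compose[OF tendsto_normal_deriv[OF u \<open>open \<Omega>\<close> x0] this]
    show "((\<lambda>t. - frechet_derivative u (at (x0 - t *\<^sub>R \<nu>)) \<nu>) \<longlongrightarrow> - normal_deriv \<Omega> u x0 \<nu>) (at_right 0)"
      by (rule tendsto_minus)
  qed (use growth in auto)
  then show ?thesis
    by simp
qed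

theorem theorem3p2:
  fixes s c0 R0 :: real
    and \<Omega> :: "'a::euclidean_space set"
    and q :: "'a \<Rightarrow> 'a"
    and u :: "'a \<Rightarrow> real"
    and x0 :: 'a
  assumes s: "0 < s" "s < 1"
    and dom: "C2_domain \<Omega>" "bounded \<Omega>"
    and q_meas: "q \<in> borel_measurable (lebesgue_on \<Omega>)"
    and q_bdd: "\<exists>C. AE x in lebesgue_on \<Omega>. norm (q x) \<le> C"
    and u_C2: "C2_closure \<Omega> u"
    and u_cont: "continuous_on UNIV u"
    and u_bdd: "bounded (range u)"
    and ineq: "AE x in lebesgue_on \<Omega>.
                 - laplacian u x + frac_lap s u x + frechet_derivative u (at x) (q x) \<ge> 0"
    and x0: "x0 \<in> frontier \<Omega>"
    and R0: "R0 > 0" "\<forall>x \<in> ball x0 R0 \<inter> frontier \<Omega>. u x = c0"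
    and ge: "\<forall>x. u x \<ge> c0"
    and nonconst: "\<exists>x. u x \<noteq> c0"
  shows "\<forall>\<nu>. outer_unit_normal \<Omega> x0 \<nu> \<longrightarrow> normal_deriv \<Omega> u x0 \<nu> < 0"
proof (intro allI impI)
  fix \<nu> assume \<nu>: "outer_unit_normal \<Omega> x0 \<nu>"
  interpret frac_lap_regular s \<Omega> u
    using s dom u_C2 u_cont u_bdd by unfold_locales (auto simp: C2_domain_def C2_closure_def)
  obtain C where C: "0 \<le> C" "\<And>x. x \<in> \<Omega> \<Longrightarrow> 0 \<le> extremal_operator s C u x"
    using extremal_operator_nonneg[OF q_bdd ineq] by blast
  have greater: "c0 < u x" if "x \<in> \<Omega>" for x
    using strong_minimum_principle[OF C(2)] ge nonconst that by blast
  obtain r where r: "norm \<nu> = 1" "0 < r" "ball (x0 - r *\<^sub>R \<nu>) r \<subseteq> \<Omega>"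
    using interior_ball_at_boundary[OF x0 \<nu>] by blast
  obtain \<kappa> where \<kappa>: "0 < \<kappa>" "\<And>t. 0 < t \<Longrightarrow> t < r \<Longrightarrow> c0 + \<kappa> * t \<le> u (x0 - t *\<^sub>R \<nu>)"
    using linear_growth_from_boundary[OF C(2,1) _ greater r] ge by blast
  have "x0 - t *\<^sub>R \<nu> \<in> \<Omega>" if "0 < t" "t < r" for t
    using inward_normal_in_ball[OF r(1) that] r(3) by blast
  moreover have "u x0 = c0"
    using R0 x0 by simp
  ultimately have "normal_deriv \<Omega> u x0 \<nu> \<le> - \<kappa>"
    using \<kappa>(2) r(1) by (intro normal_deriv_le_of_linear_growth[OF u_C2 open_\<Omega> x0 _ r(2)]) auto
  then show "normal_deriv \<Omega> u x0 \<nu> < 0"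
    using \<kappa>(1) by linarith
qed

end
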